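(* For each $n$, let $N=N_n$ be a positive integer, let $\pi_1=\pi_{1,n}$ be a probability distribution on $[0,\infty)$, and let $w=w^{(n)}=(w_0,w_1,\ldots)$ be a real sequence. Let $(Q_i,\tilde O_i)$, $i=1,\dots,N$, be independent pairs with $Q_i\sim\pi_1$ and $\tilde O_i\mid Q_i\sim\mathrm{Poi}(nQ_i)$. Define $$\tilde T_N(w)=\sum_{i=1}^N w_{\tilde O_i},\qquad S_N=\sum_{i=1}^N\tilde O_i,$$ and let $U_N(w)$ be a random variable with the law of $\tilde T_N(w)$ conditioned on the event $\{S_N=n\}$. Assume that, as $n\to\infty$, $N_n\to\infty$ and $N_n=o(n^2)$, and: (i) $\mathrm{corr}[\tilde O_1,w_{\tilde O_1}]=o(1)$; (ii) $\mathbb E[Q_1]=1/N$, and there is a constant $0<C<\infty$, not depending on $n$, such that $\pi_1$ is supported in $[0,C/n]$; (iii) $\mathrm{Var}[w_{\tilde O_1}]>0$ and $\mathbb E[|w_{\tilde O_1}|^3]<\infty$ for every $n$, and $$\frac{\mathbb E\big[|w_{\tilde O_1}-\mathbb E[w_{\tilde O_1}]|^3\big]}{\sqrt N\,\mathrm{Var}[w_{\tilde O_1}]^{3/2}}=o(1).$$ Then $$\sup_{x\in\mathbb R}\left|\Pr\left[\frac{U_N(w)-\mathbb E[\tilde T_N(w)]}{\sqrt{\mathrm{Var}[\tilde T_N(w)]}}\le x\right]-\Phi(x)\right|\longrightarrow 0\qquad (n\to\infty).$$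
   Context: $\mathrm{Poi}(\lambda)$ is the Poisson distribution with mean $\lambda$ (a point mass at $0$ if $\lambda=0$), $\Phi$ is the standard normal cumulative distribution function, and $\mathrm{corr}$ is the Pearson correlation. The mean and variance $\mathbb E[\tilde T_N(w)]$, $\mathrm{Var}[\tilde T_N(w)]$ are unconditional (not conditioned on $\{S_N=n\}$). This is a triangular-array statement: $N$, $\pi_1$ and $w$ may depend on $n$. *)

theory Defs
  imports "HOL-Probability.Probability" "HOL-Library.Landau_Symbols"
begin

(* The library's poisson_pmf is only specified for positive rates; rate 0 is the point mass at 0.
   Negative rates (also sent to the point mass at 0) never matter for nonnegative Q. *)
definition Poi :: "real \<Rightarrow> nat pmf" where
  "Poi l = (if l \<le> 0 then return_pmf 0 else poisson_pmf l)"

(* Y | X ~ K(X), i.e. K is a regular conditional distribution of Y given X: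
   P(X \<in> A, Y = k) is the integral over A of K(x){k} against the law of X. *)
definition cond_distributed ::
  "'a measure \<Rightarrow> ('a \<Rightarrow> nat) \<Rightarrow> ('a \<Rightarrow> real) \<Rightarrow> (real \<Rightarrow> nat pmf) \<Rightarrow> bool" where
  "cond_distributed M Y X K \<longleftrightarrow>
     X \<in> borel_measurable M \<and> Y \<in> M \<rightarrow>\<^sub>M count_space UNIV \<and>
     (\<forall>k. (\<lambda>x. pmf (K x) k) \<in> borel_measurable borel) \<and>
     (\<forall>A\<in>sets borel. \<forall>k.
        \<P>(\<omega> in M. X \<omega> \<in> A \<and> Y \<omega> = k) = (LINT x:A|distr M borel X. pmf (K x) k))"

definition covariance :: "'a measure \<Rightarrow> ('a \<Rightarrow> real) \<Rightarrow> ('a \<Rightarrow> real) \<Rightarrow> real" where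
  "covariance M X Y =
     prob_space.expectation M
       (\<lambda>\<omega>. (X \<omega> - prob_space.expectation M X) * (Y \<omega> - prob_space.expectation M Y))"

definition corr :: "'a measure \<Rightarrow> ('a \<Rightarrow> real) \<Rightarrow> ('a \<Rightarrow> real) \<Rightarrow> real" where
  "corr M X Y =
     covariance M X Y / (sqrt (prob_space.variance M X) * sqrt (prob_space.variance M Y))"

definition T_stat :: "nat \<Rightarrow> (nat \<Rightarrow> real) \<Rightarrow> (nat \<Rightarrow> 'a \<Rightarrow> nat) \<Rightarrow> 'a \<Rightarrow> real" where
  "T_stat N w Ot \<omega> = (\<Sum>i=1..N. w (Ot i \<omega>))"

definition S_total :: "nat \<Rightarrow> (nat \<Rightarrow> 'a \<Rightarrow> nat) \<Rightarrow> 'a \<Rightarrow> nat" where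
  "S_total N Ot \<omega> = (\<Sum>i=1..N. Ot i \<omega>)"

definition cond_law :: "'a measure \<Rightarrow> ('a \<Rightarrow> real) \<Rightarrow> 'a set \<Rightarrow> real measure" where
  "cond_law M X B = distr (uniform_measure M B) borel X"

definition Phi :: "real \<Rightarrow> real" where
  "Phi x = cdf std_normal_distribution x"

end

theory Submission
  imports Defs
begin

text \<open>
  Write \<open>X = Ot 1\<close>, \<open>\<lambda> = n/N\<close>, \<open>s\<^sup>2 = Var X\<close> and let \<open>G\<close> be the standardisation of \<open>w X\<close>.
  Fourier inversion of the event \<open>S = n\<close> (the formula of Bartlett and Holst) expresses the
  characteristic function of the standardised conditioned sum at \<open>t\<close> as the quotient \<open>I(t) / I(0)\<close>,
  where \<open>I(t)\<close> is the integral over \<open>\<bar>v\<bar> \<le> \<pi> s sqrt N\<close> of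
  \<open>\<phi>(t,v)^N\<close> with \<open>\<phi>(t,v) = E exp (i (t G + v (X - \<lambda>) / s) / sqrt N)\<close>.
  The integrand tends to \<open>exp (- (t\<^sup>2 + v\<^sup>2) / 2)\<close> by a third-moment Taylor expansion, because \<open>G\<close> and
  \<open>X\<close> are asymptotically uncorrelated. It is dominated by a Gaussian in \<open>v\<close>: the masses of \<open>X\<close>
  at \<open>0\<close> and \<open>1\<close> are at least \<open>exp (-C)\<close> and \<open>\<lambda> exp (-C)\<close>, which bounds the characteristic function of
  \<open>X\<close> away from \<open>1\<close>, and the perturbation by \<open>G\<close> is absorbed by AM-GM. Dominated convergence, the
  Levy continuity theorem and the continuity of the normal distribution function finish the proof.
\<close>

section \<open>Uniform convergence of distribution functions\<close>

text \<open>Polya's theorem. A continuous limit has quantiles \<open>q j\<close> at the levels j/m.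
  Convergence at these finitely many points is automatically uniform, and monotonicity of both
  distribution functions carries it to all points in between.\<close>

lemma weak_conv_m_imp_uniform_limit_cdf:
  fixes M :: "nat \<Rightarrow> real measure"
  assumes M: "\<And>n. real_distribution (M n)" and M': "real_distribution M'"
    and conv: "weak_conv_m M M'" and cont: "\<And>x. isCont (cdf M') x"
  shows "uniform_limit UNIV (\<lambda>n. cdf (M n)) (cdf M') sequentially"
proof (rule uniform_limitI)
  fix e :: real assume "e > 0"
  interpret Mn: real_distribution "M n" for n by (rule M)
  interpret M': real_distribution M' by (rule M')
  obtain m :: nat where m: "m > 0" "3 / real m < e"
  proof -
    obtain k :: nat where "3 / e < real k" using reals_Archimedean2 by blast
    with \<open>e > 0\<close> show ?thesis
      by (intro that[of "Suc k"]) (auto simp: field_simps)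
  qed
  \<comment> \<open>The levels 0 and 1 need not be attained, so only interior levels get a quantile;
    near the two ends the trivial bounds 0 and 1 take over.\<close>
  have "\<exists>x. cdf M' x = real j / m" if j: "0 < j" "j < m" for j
  proof -
    have "eventually (\<lambda>x. cdf M' x < real j / m) at_bot"
      using M'.cdf_lim_at_bot by (rule order_tendstoD) (use j in auto)
    then obtain a where a: "cdf M' a < real j / m" by (metis eventually_at_bot_linorder order_refl)
    have "eventually (\<lambda>x. real j / m < cdf M' x) at_top"
      using M'.cdf_lim_at_top_prob by (rule order_tendstoD) (use j in auto)
    then obtain b where b: "real j / m < cdf M' b" by (metis eventually_at_top_linorder order_refl)
    have "a \<le> b"
      using a b M'.cdf_nondecreasing[of b a] by linarith
    then show ?thesis
      using IVT[of "cdf M'" a "real j / m" b] a b cont by auto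
  qed
  then obtain q where q: "\<And>j. 0 < j \<Longrightarrow> j < m \<Longrightarrow> cdf M' (q j) = real j / m"
    by metis
  have "\<forall>j\<in>{0<..<m}. eventually (\<lambda>n. \<bar>cdf (M n) (q j) - real j / m\<bar> < 1 / m) sequentially"
  proof
    fix j assume j: "j \<in> {0<..<m}"
    have "(\<lambda>n. cdf (M n) (q j)) \<longlonglongrightarrow> real j / m"
      using conv cont[of "q j"] q[of j] j unfolding weak_conv_m_def weak_conv_def by force
    from tendstoD[OF this, of "1 / m"] m(1)
    show "eventually (\<lambda>n. \<bar>cdf (M n) (q j) - real j / m\<bar> < 1 / m) sequentially"
      by (simp add: dist_real_def)
  qed
  then have "eventually (\<lambda>n. \<forall>j\<in>{0<..<m}. \<bar>cdf (M n) (q j) - real j / m\<bar> < 1 / m) sequentially"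
    by (simp add: eventually_ball_finite)
  then show "\<forall>\<^sub>F n in sequentially. \<forall>x\<in>UNIV. dist (cdf (M n) x) (cdf M' x) < e"
  proof eventually_elim
    case (elim n)
    show ?case
    proof
      fix x :: real
      define j where "j = nat \<lfloor>m * cdf M' x\<rfloor>"
      have F0: "0 \<le> cdf M' x" and F1: "cdf M' x \<le> 1"
        by (rule M'.cdf_nonneg) (rule M'.cdf_bounded_prob)
      have G0: "0 \<le> cdf (M n) x" and G1: "cdf (M n) x \<le> 1"
        by (rule Mn.cdf_nonneg) (rule Mn.cdf_bounded_prob)
      have j: "real j \<le> m * cdf M' x" "m * cdf M' x < real j + 1"
        using F0 unfolding j_def by (auto simp: nat_le_iff)
      then have j': "real j / m \<le> cdf M' x" "cdf M' x < real (Suc j) / m"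
        using m(1) by (auto simp: field_simps)
      \<comment> \<open>The quantile at \<open>j - 1\<close> is used because
        \<open>real j / m \<le> cdf M' x\<close> need not be strict, and where \<open>cdf M'\<close>
        is flat only a strict inequality of values orders the points. One cell for \<open>x\<close>,
        one for this neighbour and one for the error at the quantile make up the constant 3.\<close>
      have lower: "(real j - 2) / m \<le> cdf (M n) x"
      proof (cases "2 \<le> j")
        case True
        have "real m * cdf M' x \<le> m"
          using F1 by (simp add: mult_left_le)
        with j(1) True have J: "0 < j - 1" "j - 1 < m"
          by auto
        then have "cdf M' (q (j - 1)) < cdf M' x"
          using q[of "j - 1"] j'(1) True m(1)
          by (auto simp: of_nat_diff diff_divide_distrib intro: less_le_trans[of _ "real j / m"])
        then have "q (j - 1) \<le> x"
          using M'.cdf_nondecreasing[of x "q (j - 1)"] by linarith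
        moreover have "\<bar>cdf (M n) (q (j - 1)) - real (j - 1) / m\<bar> < 1 / m"
          using bspec[OF elim, of "j - 1"] J by simp
        ultimately show ?thesis
          using Mn.cdf_nondecreasing[of "q (j - 1)" x n] True by (auto simp: of_nat_diff diff_divide_distrib)
      next
        case False
        then have "(real j - 2) / m \<le> 0" by (auto simp: divide_nonpos_nonneg)
        with G0 show ?thesis by linarith
      qed
      have upper: "cdf (M n) x \<le> (real j + 2) / m"
      proof (cases "Suc j < m")
        case True
        then have "cdf M' x < cdf M' (q (Suc j))"
          using q[of "Suc j"] j'(2) by auto
        then have "x \<le> q (Suc j)"
          using M'.cdf_nondecreasing[of "q (Suc j)" x] by linarith
        moreover have "\<bar>cdf (M n) (q (Suc j)) - real (Suc j) / m\<bar> < 1 / m"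
          using bspec[OF elim, of "Suc j"] True by simp
        ultimately show ?thesis
          using Mn.cdf_nondecreasing[of x "q (Suc j)" n] by (auto simp: add_divide_distrib)
      next
        case False
        then have "1 \<le> (real j + 2) / m" using m(1) by (auto simp: field_simps)
        with G1 show ?thesis by linarith
      qed
      from lower upper j' have "\<bar>cdf (M n) x - cdf M' x\<bar> \<le> 3 / m"
        by (auto simp: add_divide_distrib diff_divide_distrib)
      with m(2) show "dist (cdf (M n) x) (cdf M' x) < e"
        by (simp add: dist_real_def)
    qed
  qed
qed

section \<open>Mixed Poisson variables\<close>

text \<open>Binomial moments are convenient because the factorials cancel and leave the exponential
  series shifted by \<open>j\<close>. Rate 0 is treated apart, \<open>Poi\<close> being a point mass
  there.\<close>

lemma sums_binomial_poisson:
  fixes l :: real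
  assumes "0 \<le> l"
  shows "(\<lambda>k. real (k choose j) * pmf (Poi l) k) sums (l ^ j / fact j)"
proof (cases "l = 0")
  case True
  have "(\<lambda>k. real (k choose j) * pmf (Poi l) k) = (\<lambda>k. if k = 0 then real (0 choose j) else 0)"
    using True by (auto simp: Poi_def fun_eq_iff indicator_def)
  moreover have "\<dots> sums real (0 choose j)"
    using sums_single[of 0 "\<lambda>_. real (0 choose j)"] by simp
  ultimately show ?thesis using True by (cases j) auto
next
  case False
  with assms have l: "l > 0" by simp
  have "(\<lambda>k. l ^ k / fact k) sums exp l"
    using exp_converges[of l] by (simp add: divide_inverse mult.commute)
  then have "(\<lambda>k. l ^ j / fact j * exp (- l) * (l ^ k / fact k)) sums (l ^ j / fact j * exp (- l) * exp l)"
    by (rule sums_mult)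
  then have "(\<lambda>k. l ^ j / fact j * exp (- l) * (l ^ k / fact k)) sums (l ^ j / fact j)"
    by (simp add: mult.assoc flip: exp_add)
  moreover have "(\<lambda>k. l ^ j / fact j * exp (- l) * (l ^ k / fact k)) =
      (\<lambda>k. real (k + j choose j) * pmf (Poi l) (k + j))"
    using l by (auto simp: fun_eq_iff Poi_def binomial_fact power_add field_simps)
  ultimately show ?thesis
    by (subst sums_zero_iff_shift[of j, symmetric]) auto
qed

text \<open>The coefficients are j! S(3, j) with Stirling numbers of the second kind; this reduces
  third moments to binomial moments.\<close>

lemma cube_eq_binomial: "real k ^ 3 = 6 * real (k choose 3) + 6 * real (k choose 2) + real (k choose 1)"
proof (induction k)
  case (Suc k)
  have "real (Suc k choose 3) = real (k choose 3) + real (k choose 2)"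
    "real (Suc k choose 2) = real (k choose 2) + real k"
    by (simp_all add: numeral_3_eq_3 numeral_2_eq_2)
  moreover have "real (k choose 2) = real k * (real k - 1) / 2"
    by (induction k) (auto simp: numeral_2_eq_2 field_simps)
  ultimately show ?case using Suc by (simp add: algebra_simps power3_eq_cube)
qed (auto simp: numeral_3_eq_3)

lemma square_eq_binomial: "real k ^ 2 = 2 * real (k choose 2) + real (k choose 1)"
  by (induction k) (auto simp: numeral_2_eq_2 algebra_simps)

lemma measurable_pmf_Poi [measurable]: "(\<lambda>l. pmf (Poi l) k) \<in> borel_measurable borel"
proof -
  have "(\<lambda>l. pmf (Poi l) k) = (\<lambda>l. if l \<le> 0 then indicator {0} k else l ^ k / fact k * exp (- l))"
    by (auto simp: fun_eq_iff Poi_def indicator_def)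
  then show ?thesis by simp
qed

text \<open>\<open>D\<close> models the law of the random rate n Q_1, bounded by a \<open>C\<close>
  that is the same for all n. Of the pair only the marginal law of the count is kept; the mixing
  variable enters through \<open>D\<close> alone.\<close>

locale mixed_poisson = prob_space M + D: prob_space D
  for M :: "'a measure" and D :: "real measure" +
  fixes X :: "'a \<Rightarrow> nat" and C :: real
  assumes X_meas [measurable]: "X \<in> M \<rightarrow>\<^sub>M count_space UNIV"
    and D_sets [measurable_cong]: "sets D = sets borel"
    and D_supp: "AE l in D. l \<in> {0..C}"
    and X_law: "\<And>k. prob {\<omega> \<in> space M. X \<omega> = k} = (\<integral>l. pmf (Poi l) k \<partial>D)"
begin

lemma C_nonneg: "0 \<le> C"
proof (rule ccontr)
  assume "\<not> 0 \<le> C"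
  with D_supp have "AE l in D. False" by (auto elim: AE_mp)
  then show False by simp
qed

lemma integrable_D_bounded:
  fixes f :: "real \<Rightarrow> real"
  assumes "f \<in> borel_measurable borel" "\<And>l. 0 \<le> l \<Longrightarrow> l \<le> C \<Longrightarrow> \<bar>f l\<bar> \<le> B"
  shows "integrable D f"
proof (rule D.integrable_const_bound[of _ B])
  show "AE l in D. norm (f l) \<le> B"
    using D_supp by eventually_elim (use assms in auto)
  show "f \<in> borel_measurable D" using assms(1) by simp
qed

lemma integrable_D_power [simp]: "integrable D (\<lambda>l. l ^ j)"
  by (rule integrable_D_bounded[where B = "C ^ j"]) (auto simp: power_mono)

lemma nn_integral_D_pmf: "(\<integral>\<^sup>+l. ennreal (pmf (Poi l) k) \<partial>D) = emeasure M {\<omega> \<in> space M. X \<omega> = k}"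
proof -
  have "integrable D (\<lambda>l. pmf (Poi l) k)"
    by (rule integrable_D_bounded[where B = 1]) (auto simp: pmf_le_1)
  then show ?thesis
    by (simp add: emeasure_eq_measure X_law nn_integral_eq_integral)
qed

text \<open>Tonelli over the partition by the values of \<open>X\<close> gives integrability and
  value at once, with \<open>sums_binomial_poisson\<close> applied under the mixing law.\<close>

lemma has_bochner_integral_binomial:
  "has_bochner_integral M (\<lambda>\<omega>. real (X \<omega> choose j)) ((\<integral>l. l ^ j \<partial>D) / fact j)"
proof (rule has_bochner_integral_nn_integral)
  have "(\<integral>\<^sup>+\<omega>. ennreal (real (X \<omega> choose j)) \<partial>M) =
      (\<integral>\<^sup>+\<omega>. (\<Sum>k. ennreal (real (k choose j)) * indicator {\<omega> \<in> space M. X \<omega> = k} \<omega>) \<partial>M)"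
  proof (rule nn_integral_cong)
    fix \<omega> assume "\<omega> \<in> space M"
    then have "(\<Sum>k. ennreal (real (k choose j)) * indicator {\<omega> \<in> space M. X \<omega> = k} \<omega>) =
        (\<Sum>k\<in>{X \<omega>}. ennreal (real (k choose j)) * indicator {\<omega> \<in> space M. X \<omega> = k} \<omega>)"
      by (intro suminf_finite) auto
    with \<open>\<omega> \<in> space M\<close> show "ennreal (real (X \<omega> choose j)) =
        (\<Sum>k. ennreal (real (k choose j)) * indicator {\<omega> \<in> space M. X \<omega> = k} \<omega>)"
      by simp
  qed
  also have "\<dots> = (\<Sum>k. ennreal (real (k choose j)) * emeasure M {\<omega> \<in> space M. X \<omega> = k})"
    by (subst nn_integral_suminf) (auto simp: nn_integral_cmult_indicator)
  also have "\<dots> = (\<Sum>k. \<integral>\<^sup>+l. ennreal (real (k choose j) * pmf (Poi l) k) \<partial>D)"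
    by (simp add: ennreal_mult nn_integral_cmult flip: nn_integral_D_pmf)
  also have "\<dots> = (\<integral>\<^sup>+l. (\<Sum>k. ennreal (real (k choose j) * pmf (Poi l) k)) \<partial>D)"
    by (subst nn_integral_suminf) auto
  also have "\<dots> = (\<integral>\<^sup>+l. ennreal (l ^ j / fact j) \<partial>D)"
  proof (rule nn_integral_cong_AE, use D_supp in eventually_elim)
    fix l assume "l \<in> {0..C}"
    then show "(\<Sum>k. ennreal (real (k choose j) * pmf (Poi l) k)) = ennreal (l ^ j / fact j)"
      using sums_binomial_poisson[of l j] by (simp add: sums_iff suminf_ennreal2)
  qed
  also have "\<dots> = ennreal ((\<integral>l. l ^ j \<partial>D) / fact j)"
    by (subst nn_integral_eq_integral) (use D_supp in \<open>auto elim!: AE_mp\<close>)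
  finally show "(\<integral>\<^sup>+\<omega>. ennreal (real (X \<omega> choose j)) \<partial>M) = ennreal ((\<integral>l. l ^ j \<partial>D) / fact j)" .
  show "0 \<le> (\<integral>l. l ^ j \<partial>D) / fact j"
    by (intro divide_nonneg_nonneg integral_nonneg_AE) (use D_supp in \<open>auto elim!: AE_mp\<close>)
qed auto

lemma integrable_binomial [simp]: "integrable M (\<lambda>\<omega>. real (X \<omega> choose j))"
  and expectation_binomial: "expectation (\<lambda>\<omega>. real (X \<omega> choose j)) = (\<integral>l. l ^ j \<partial>D) / fact j"
  using has_bochner_integral_binomial[of j]
  by (auto simp: has_bochner_integral_iff)

definition rate :: real where "rate = (\<integral>l. l \<partial>D)"

lemma rate_nonneg: "0 \<le> rate"
  unfolding rate_def by (intro integral_nonneg_AE) (use D_supp in \<open>auto elim!: AE_mp\<close>)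

text \<open>On [0, C] all factors of the power but one are bounded by \<open>C\<close>. Keeping one
  factor makes every moment bound linear in \<open>rate\<close>, which matters because
  \<open>rate\<close> is n/N in the application and may tend to 0.\<close>

lemma moment_D_le: "(\<integral>l. l ^ Suc j \<partial>D) \<le> C ^ j * rate"
proof -
  have "(\<integral>l. l ^ Suc j \<partial>D) \<le> (\<integral>l. C ^ j * l \<partial>D)"
  proof (rule integral_mono_AE)
    show "integrable D (\<lambda>l. C ^ j * l)"
      using integrable_D_power[of 1] by simp
    show "AE l in D. l ^ Suc j \<le> C ^ j * l"
      using D_supp
    proof eventually_elim
      case (elim l)
      then have "l ^ j * l \<le> C ^ j * l" by (intro mult_right_mono power_mono) auto
      then show ?case by (simp add: mult.commute)
    qed
  qed (rule integrable_D_power)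
  then show ?thesis by (simp add: rate_def)
qed

lemma integrable_X [simp]: "integrable M (\<lambda>\<omega>. real (X \<omega>))"
  and expectation_X: "expectation (\<lambda>\<omega>. real (X \<omega>)) = rate"
  using integrable_binomial[of 1] expectation_binomial[of 1] by (simp_all add: rate_def)

lemma integrable_X2 [simp]: "integrable M (\<lambda>\<omega>. real (X \<omega>) ^ 2)"
  and expectation_X2: "expectation (\<lambda>\<omega>. real (X \<omega>) ^ 2) = (\<integral>l. l ^ 2 \<partial>D) + rate"
  unfolding square_eq_binomial using expectation_binomial[of 2] expectation_binomial[of 1]
  by (simp_all del: choose_one add: rate_def)

lemma integrable_X3 [simp]: "integrable M (\<lambda>\<omega>. real (X \<omega>) ^ 3)"
  and expectation_X3: "expectation (\<lambda>\<omega>. real (X \<omega>) ^ 3) = (\<integral>l. l ^ 3 \<partial>D) + 3 * (\<integral>l. l ^ 2 \<partial>D) + rate"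
  unfolding cube_eq_binomial
  using expectation_binomial[of 3] expectation_binomial[of 2] expectation_binomial[of 1]
  by (simp_all del: choose_one add: rate_def fact_numeral)

lemma expectation_X2_le: "expectation (\<lambda>\<omega>. real (X \<omega>) ^ 2) \<le> (C + 1) * rate"
  unfolding expectation_X2 using moment_D_le[of 1] by (simp add: algebra_simps power2_eq_square)

lemma expectation_X3_le: "expectation (\<lambda>\<omega>. real (X \<omega>) ^ 3) \<le> (C\<^sup>2 + 3 * C + 1) * rate"
  unfolding expectation_X3 using moment_D_le[of 1] moment_D_le[of 2]
  by (simp add: algebra_simps power2_eq_square power3_eq_cube)

text \<open>Mixing only adds variance: Var X is the Poisson part \<open>rate\<close> plus the
  variance of the mixing law.\<close>

lemma variance_X_ge: "rate \<le> variance (\<lambda>\<omega>. real (X \<omega>))"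
proof -
  have "rate\<^sup>2 \<le> (\<integral>l. l ^ 2 \<partial>D)"
    using D.variance_positive[of "\<lambda>l. l"] integrable_D_power[of 1] integrable_D_power[of 2]
      D.variance_eq[of "\<lambda>l. l"]
    by (simp only: rate_def power_one_right)
  then show ?thesis
    by (subst variance_eq) (auto simp: expectation_X expectation_X2)
qed

lemma variance_X_le: "variance (\<lambda>\<omega>. real (X \<omega>)) \<le> (C + 1) * rate"
  using expectation_X2_le by (subst variance_eq) (auto simp: intro: order_trans[rotated])

lemma rate_le: "rate \<le> C"
proof -
  have "rate \<le> (\<integral>l. C \<partial>D)"
    unfolding rate_def using integrable_D_power[of 1] D_supp
    by (intro integral_mono_AE) (auto elim!: AE_mp)
  then show ?thesis by (simp add: D.prob_space)
qed

text \<open>The bound is again linear in \<open>rate\<close>. Divided by \<open>std ^ 3\<close>,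
  which is at least \<open>rate\<close> to the power 3/2, it leaves an inverse square root of
  \<open>rate\<close>.\<close>

lemma third_central_moment_le:
  "expectation (\<lambda>\<omega>. \<bar>real (X \<omega>) - rate\<bar> ^ 3) \<le> (C\<^sup>2 + 3 * C + 1 + C\<^sup>2) * rate"
  and integrable_third_central_moment: "integrable M (\<lambda>\<omega>. \<bar>real (X \<omega>) - rate\<bar> ^ 3)"
proof -
  have b: "\<bar>real k - rate\<bar> ^ 3 \<le> real k ^ 3 + rate ^ 3" for k
  proof -
    have "\<bar>real k - rate\<bar> ^ 3 \<le> max (real k) rate ^ 3"
      by (rule power_mono) (use rate_nonneg in auto)
    also have "\<dots> \<le> real k ^ 3 + rate ^ 3"
      using rate_nonneg by (auto simp: max_def)
    finally show ?thesis .
  qed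
  show I: "integrable M (\<lambda>\<omega>. \<bar>real (X \<omega>) - rate\<bar> ^ 3)"
    by (rule Bochner_Integration.integrable_bound[of _ "\<lambda>\<omega>. real (X \<omega>) ^ 3 + rate ^ 3"])
       (use b rate_nonneg in \<open>auto\<close>)
  have "expectation (\<lambda>\<omega>. \<bar>real (X \<omega>) - rate\<bar> ^ 3) \<le> expectation (\<lambda>\<omega>. real (X \<omega>) ^ 3 + rate ^ 3)"
    by (rule integral_mono) (use I b in auto)
  also have "\<dots> \<le> (C\<^sup>2 + 3 * C + 1) * rate + rate ^ 3"
    using expectation_X3_le by (simp add: prob_space)
  also have "rate ^ 3 \<le> C\<^sup>2 * rate"
    using rate_le rate_nonneg by (auto simp: power3_eq_cube power2_eq_square intro!: mult_right_mono mult_mono)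
  finally show "expectation (\<lambda>\<omega>. \<bar>real (X \<omega>) - rate\<bar> ^ 3) \<le> (C\<^sup>2 + 3 * C + 1 + C\<^sup>2) * rate"
    by (simp add: algebra_simps)
qed

text \<open>The Poisson mass exp(-l) at 0 is smallest at l = C. Together with the mass at the
  adjacent point 1, bounded next, this expresses quantitatively that \<open>X\<close> has lattice
  span 1.\<close>

lemma prob_X_eq_0_ge: "exp (- C) \<le> prob {\<omega> \<in> space M. X \<omega> = 0}"
proof -
  have "(\<integral>l. exp (- C) \<partial>D) \<le> (\<integral>l. pmf (Poi l) 0 \<partial>D)"
  proof (rule integral_mono_AE)
    show "integrable D (\<lambda>l. pmf (Poi l) 0)"
      by (rule integrable_D_bounded[where B = 1]) (auto simp: pmf_le_1)
    show "AE l in D. exp (- C) \<le> pmf (Poi l) 0"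
      using D_supp by eventually_elim (use C_nonneg in \<open>auto simp: Poi_def\<close>)
  qed simp
  then show ?thesis by (simp add: X_law D.prob_space)
qed

lemma prob_X_eq_1_ge: "rate * exp (- C) \<le> prob {\<omega> \<in> space M. X \<omega> = 1}"
proof -
  have "(\<integral>l. l * exp (- C) \<partial>D) \<le> (\<integral>l. pmf (Poi l) 1 \<partial>D)"
  proof (rule integral_mono_AE)
    show "integrable D (\<lambda>l. l * exp (- C))"
      using integrable_D_power[of 1] by simp
    show "integrable D (\<lambda>l. pmf (Poi l) 1)"
      by (rule integrable_D_bounded[where B = 1]) (auto simp: pmf_le_1)
    show "AE l in D. l * exp (- C) \<le> pmf (Poi l) 1"
      using D_supp by eventually_elim (auto simp: Poi_def)
  qed
  then show ?thesis by (simp add: X_law rate_def)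
qed

end

section \<open>Characteristic function estimates\<close>

text \<open>Half-angle formula: 1 - cos x = 2 (sin u)^2 with u = |x|/2, and sin u is at least u/3 on
  [0, 2], which contains u because pi < 4. The constant is 2 * (1/9) * (1/4) = 1/18.\<close>

lemma cos_le_one_minus_square:
  fixes x :: real
  assumes "\<bar>x\<bar> \<le> pi"
  shows "x\<^sup>2 / 18 \<le> 1 - cos x"
proof -
  define u where "u = \<bar>x\<bar> / 2"
  have u: "0 \<le> u" "u \<le> 2" using assms pi_less_4 by (auto simp: u_def)
  \<comment> \<open>The quadratic Taylor polynomial of \<open>iexp u\<close> has imaginary part
    \<open>u\<close>, so the remainder estimate for \<open>iexp\<close> controls the sine.\<close>
  have "\<bar>sin u - u\<bar> \<le> cmod (iexp u - (\<Sum>k\<le>2. (\<i> * u) ^ k / fact k))"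
    using abs_Im_le_cmod[of "iexp u - (\<Sum>k\<le>2. (\<i> * u) ^ k / fact k)"]
    by (simp add: numeral_2_eq_2 Im_exp)
  also have "\<dots> \<le> u ^ 3 / 6"
    using iexp_approx1[of u 2] u by (simp add: fact_numeral eval_nat_numeral)
  also have "u ^ 3 / 6 \<le> 4 * u / 6"
  proof -
    have "u ^ 2 \<le> 2 ^ 2" using u by (intro power_mono) auto
    then have "u ^ 2 * u \<le> 4 * u" using u by (intro mult_right_mono) auto
    then show ?thesis by (simp add: power3_eq_cube power2_eq_square)
  qed
  finally have "u / 3 \<le> sin u" by linarith
  then have "(u / 3)\<^sup>2 \<le> (sin u)\<^sup>2" using u by (intro power_mono) auto
  moreover have "cos x = 1 - 2 * (sin u)\<^sup>2"
    using cos_double_sin[of u] by (simp add: u_def)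
  ultimately show ?thesis by (simp add: u_def power_divide)
qed

lemma iexp_add: "iexp (x + y) = iexp x * iexp y"
  by (simp add: distrib_left exp_add)

text \<open>Orthogonality of characters over one full period, stretched to length
  \<open>2 * pi * b\<close>. It is what isolates a single value of an integer variable.\<close>

lemma integral_iexp_lattice:
  fixes k :: int and b :: real
  assumes b: "b > 0"
  shows "(LINT v|lborel. indicator {- (pi * b)..pi * b} v *\<^sub>R iexp (v / b * k)) = (if k = 0 then 2 * pi * b else 0)"
proof (cases "k = 0")
  case True
  then show ?thesis using b by (simp add: scaleR_conv_of_real)
next
  case False
  let ?F = "\<lambda>v. of_real b / (\<i> * of_int k) * iexp (v / b * k)"
  have "(LINT v|lborel. indicator {- (pi * b)..pi * b} v *\<^sub>R iexp (v / b * k)) = ?F (pi * b) - ?F (- (pi * b))"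
  proof (rule integral_FTC_Icc)
    show "- (pi * b) \<le> pi * b" using b by simp
    show "continuous_on {- (pi * b)..pi * b} (\<lambda>v. iexp (v / b * k))"
      using b by (intro continuous_intros) auto
    fix x
    show "(?F has_vector_derivative iexp (x / b * k)) (at x within {- (pi * b)..pi * b})"
      using b False
      by (auto intro!: derivative_eq_intros has_vector_derivative_real_field simp: field_simps)
  qed
  \<comment> \<open>The two endpoint values are complex conjugates of each other and agree because
    sin (pi k) = 0.\<close>
  also have "iexp (pi * b / b * k) = iexp (- (pi * b) / b * k)"
  proof -
    have "sin (pi * real_of_int k) = 0" by (metis mult.commute sin_integer_2pi sin_npi_int)
    then show ?thesis using b by (simp add: exp_eq_polar cis.ctr complex_eq_iff Re_exp Im_exp)
  qed
  finally show ?thesis using False by simp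
qed

context prob_space
begin

lemma integrable_iexp_comp:
  "random_variable borel f \<Longrightarrow> integrable M (\<lambda>\<omega>. iexp (f \<omega>))"
  by (rule integrable_const_bound[of _ 1]) auto

lemma norm_expectation_iexp_le_1: "norm (expectation (\<lambda>\<omega>. iexp (f \<omega>))) \<le> 1"
proof (cases "integrable M (\<lambda>\<omega>. iexp (f \<omega>))")
  case True
  have "norm (expectation (\<lambda>\<omega>. iexp (f \<omega>))) \<le> expectation (\<lambda>\<omega>. norm (iexp (f \<omega>)))"
    by (rule integral_norm_bound)
  then show ?thesis by (simp add: prob_space)
\<comment> \<open>Without integrability the expectation takes the default value 0.\<close>
qed (simp add: not_integrable_integral_eq)

lemma integrable_lower_powers:
  fixes W :: "'a \<Rightarrow> real"
  assumes [measurable]: "random_variable borel W" and I: "integrable M (\<lambda>\<omega>. \<bar>W \<omega>\<bar> ^ 3)"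
  shows "integrable M W" "integrable M (\<lambda>\<omega>. (W \<omega>)\<^sup>2)"
proof -
  have b: "\<bar>x\<bar> \<le> 1 + \<bar>x\<bar> ^ 3" "x\<^sup>2 \<le> 1 + \<bar>x\<bar> ^ 3" for x :: real
  proof -
    have "\<bar>x\<bar> \<le> 1 + \<bar>x\<bar> ^ 3 \<and> \<bar>x\<bar>\<^sup>2 \<le> 1 + \<bar>x\<bar> ^ 3"
    proof (cases "\<bar>x\<bar> \<le> 1")
      case True
      then have "\<bar>x\<bar>\<^sup>2 \<le> 1" by (intro power_le_one) auto
      then show ?thesis using True by (auto intro: order_trans[of _ 1])
    next
      case False
      then have "\<bar>x\<bar> ^ 1 \<le> \<bar>x\<bar> ^ 3" "\<bar>x\<bar> ^ 2 \<le> \<bar>x\<bar> ^ 3" by (intro power_increasing; simp)+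
      then show ?thesis by auto
    qed
    then show "\<bar>x\<bar> \<le> 1 + \<bar>x\<bar> ^ 3" "x\<^sup>2 \<le> 1 + \<bar>x\<bar> ^ 3" by auto
  qed
  show "integrable M W" "integrable M (\<lambda>\<omega>. (W \<omega>)\<^sup>2)"
    by (rule Bochner_Integration.integrable_bound[of _ "\<lambda>\<omega>. 1 + \<bar>W \<omega>\<bar> ^ 3"],
        use I b in \<open>auto\<close>)+
qed

text \<open>A quantitative central limit theorem. One factor is within third-order Taylor error of 1
  - x, and 1 - x is within x^2 of exp(-x), where x is half the variance over \<open>N\<close>. For
  numbers of modulus at most 1, taking N-th powers multiplies the distance by at most
  \<open>N\<close>.\<close>

lemma norm_expectation_iexp_power_diff_le:
  fixes W :: "'a \<Rightarrow> real" and N :: nat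
  assumes [measurable]: "random_variable borel W" and I: "integrable M (\<lambda>\<omega>. \<bar>W \<omega>\<bar> ^ 3)"
    and mean: "expectation W = 0" and N: "N > 0"
  shows "norm (expectation (\<lambda>\<omega>. iexp (W \<omega> / sqrt N)) ^ N - complex_of_real (exp (- expectation (\<lambda>\<omega>. (W \<omega>)\<^sup>2) / 2)))
    \<le> expectation (\<lambda>\<omega>. \<bar>W \<omega>\<bar> ^ 3) / (6 * sqrt N) + (expectation (\<lambda>\<omega>. (W \<omega>)\<^sup>2))\<^sup>2 / (4 * N)"
proof -
  note I2 = integrable_lower_powers[OF assms(1) I]
  define a where "a = expectation (\<lambda>\<omega>. (W \<omega>)\<^sup>2)"
  define b where "b = expectation (\<lambda>\<omega>. \<bar>W \<omega>\<bar> ^ 3)"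
  define \<phi> where "\<phi> = expectation (\<lambda>\<omega>. iexp (W \<omega> / sqrt N))"
  define x where "x = a / (2 * N)"
  have a: "0 \<le> a" by (simp add: a_def)
  then have x: "0 \<le> x" by (simp add: x_def)
  have \<phi>: "\<phi> = char (distr M borel W) (1 / sqrt N)"
    by (simp add: \<phi>_def char_def integral_distr)
  have "variance W = a" using I2 mean by (simp add: a_def)
  then have "norm (\<phi> - (1 - x)) \<le> (1 / sqrt N)\<^sup>2 / 6 *
      expectation (\<lambda>\<omega>. min (6 * (W \<omega>)\<^sup>2) (\<bar>1 / sqrt N\<bar> * \<bar>W \<omega>\<bar> ^ 3))"
    using char_approx3'[OF assms(1) I2 mean _ refl, of a "1 / sqrt N"] N
    by (simp add: \<phi> x_def power_divide mult.commute)
  also have "expectation (\<lambda>\<omega>. min (6 * (W \<omega>)\<^sup>2) (\<bar>1 / sqrt N\<bar> * \<bar>W \<omega>\<bar> ^ 3)) \<le>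
      expectation (\<lambda>\<omega>. \<bar>1 / sqrt N\<bar> * \<bar>W \<omega>\<bar> ^ 3)"
    by (rule integral_mono) (use I I2 in auto)
  also have "\<dots> = b / sqrt N" by (simp add: b_def)
  finally have 1: "norm (\<phi> - (1 - x)) \<le> b / sqrt N / (6 * N)"
    using N by (simp add: power_divide mult_left_mono divide_right_mono mult.commute mult.left_commute)
  \<comment> \<open>The upper bound for exp(-x) uses \<open>(1 - x + x\<^sup>2) * (1 + x)\<close> =
    1 + x^3, which is at least 1.\<close>
  have 2: "\<bar>(1 - x) - exp (- x)\<bar> \<le> x\<^sup>2"
  proof -
    have "exp (- x) \<le> 1 / (1 + x)"
      using x exp_ge_add_one_self[of x] by (simp add: exp_minus field_simps)
    also have "\<dots> \<le> 1 - x + x\<^sup>2"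
    proof -
      have "1 \<le> (1 - x + x\<^sup>2) * (1 + x)"
        using x by (simp add: algebra_simps power2_eq_square)
      then show ?thesis using x by (simp add: divide_le_eq)
    qed
    finally show ?thesis using exp_ge_add_one_self[of "- x"] by simp
  qed
  have "norm (\<phi> ^ N - complex_of_real (exp (- x)) ^ N) \<le> N * norm (\<phi> - complex_of_real (exp (- x)))"
    by (rule norm_power_diff) (use x in \<open>auto simp: \<phi>_def norm_expectation_iexp_le_1 simp del: of_real_divide of_real_exp\<close>)
  also have "norm (\<phi> - complex_of_real (exp (- x))) \<le>
      norm (\<phi> - (1 - x)) + norm (complex_of_real ((1 - x) - exp (- x)))"
    using norm_triangle_ineq[of "\<phi> - (1 - x)" "complex_of_real ((1 - x) - exp (- x))"] by simp
  also have "\<dots> \<le> b / sqrt N / (6 * N) + x\<^sup>2"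
    using 1 2 by (simp del: of_real_diff of_real_exp)
  finally have "norm (\<phi> ^ N - complex_of_real (exp (- x)) ^ N) \<le> N * (b / sqrt N / (6 * N) + x\<^sup>2)"
    using N by (simp add: mult_left_mono)
  also have "\<dots> = b / (6 * sqrt N) + a\<^sup>2 / (4 * N)"
    using N by (simp add: x_def field_simps power2_eq_square)
  also have "complex_of_real (exp (- x)) ^ N = exp (- a / 2)"
    using N by (simp add: x_def flip: exp_of_nat_mult of_real_power)
  finally show ?thesis by (simp add: \<phi>_def a_def b_def)
qed

text \<open>Only the atoms at 0 and 1 are tracked: the squared modulus of
  \<open>p 0 + p 1 * iexp \<theta>\<close> falls short of \<open>(p 0 + p 1)\<^sup>2\<close> by
  twice the claimed gain. All other values contribute at most their total mass.\<close>

lemma norm_expectation_iexp_nat_le: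
  fixes X :: "'a \<Rightarrow> nat" and \<theta> :: real
  assumes [measurable]: "X \<in> M \<rightarrow>\<^sub>M count_space UNIV"
  defines "p \<equiv> \<lambda>k. prob {\<omega> \<in> space M. X \<omega> = k}"
  shows "norm (expectation (\<lambda>\<omega>. iexp (\<theta> * X \<omega>))) \<le> 1 - p 0 * p 1 * (1 - cos \<theta>)"
proof -
  let ?A = "\<lambda>k. {\<omega> \<in> space M. X \<omega> = k}" and ?B = "{\<omega> \<in> space M. X \<omega> \<ge> 2}"
  have "prob (?A 0 \<union> ?A 1 \<union> ?B) = p 0 + p 1 + prob ?B"
    unfolding p_def by (subst finite_measure_Union; (subst finite_measure_Union)?) auto
  moreover have "?A 0 \<union> ?A 1 \<union> ?B = space M" by auto
  ultimately have B: "prob ?B = 1 - p 0 - p 1" using prob_space by simp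
  have p: "0 \<le> p 0" "0 \<le> p 1" "p 0 + p 1 \<le> 1"
    using B measure_nonneg[of M ?B] by (auto simp: p_def)
  define d where "d = p 0 * p 1 * (1 - cos \<theta>)"
  have c: "0 \<le> 1 - cos \<theta>" "1 - cos \<theta> \<le> 2" using cos_ge_minus_one[of \<theta>] by auto
  have d: "0 \<le> d" using c p by (simp add: d_def)
  \<comment> \<open>This makes \<open>p 0 + p 1 - d\<close> nonnegative, so that roots can be taken
    in the comparison of squares below.\<close>
  have d2: "d \<le> p 0 + p 1"
  proof -
    have "d \<le> p 0 * p 1 * 2" unfolding d_def using c p by (intro mult_left_mono) auto
    also have "p 0 * p 1 \<le> p 0" "p 0 * p 1 \<le> p 1" using p by (auto simp: mult_left_le mult_left_le_one_le)
    then have "p 0 * p 1 * 2 \<le> p 0 + p 1" by linarith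
    finally show ?thesis .
  qed
  have split: "expectation (\<lambda>\<omega>. iexp (\<theta> * X \<omega>)) =
      p 0 + p 1 * iexp \<theta> + expectation (\<lambda>\<omega>. indicator ?B \<omega> *\<^sub>R iexp (\<theta> * X \<omega>))"
  proof -
    have "expectation (\<lambda>\<omega>. iexp (\<theta> * X \<omega>)) = expectation (\<lambda>\<omega>.
        indicator (?A 0) \<omega> *\<^sub>R 1 + indicator (?A 1) \<omega> *\<^sub>R iexp \<theta> + indicator ?B \<omega> *\<^sub>R iexp (\<theta> * X \<omega>))"
      by (intro Bochner_Integration.integral_cong)
         (auto simp: indicator_def not_le numeral_2_eq_2 less_Suc_eq)
    also have "\<dots> = p 0 + p 1 * iexp \<theta> + expectation (\<lambda>\<omega>. indicator ?B \<omega> *\<^sub>R iexp (\<theta> * X \<omega>))"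
    proof -
      have "integrable M (\<lambda>\<omega>. indicator (?A k) \<omega> *\<^sub>R z)"
        "expectation (\<lambda>\<omega>. indicator (?A k) \<omega> *\<^sub>R z) = p k * z" for k and z :: complex
        by (rule integrable_mult_indicator) (simp_all add: p_def scaleR_conv_of_real)
      moreover have "integrable M (\<lambda>\<omega>. indicator ?B \<omega> *\<^sub>R iexp (\<theta> * X \<omega>))"
        by (intro integrable_mult_indicator integrable_iexp_comp) simp_all
      ultimately show ?thesis by (simp del: of_real_mult)
    qed
    finally show ?thesis .
  qed
  have "norm (expectation (\<lambda>\<omega>. indicator ?B \<omega> *\<^sub>R iexp (\<theta> * X \<omega>))) \<le>
      expectation (\<lambda>\<omega>. norm (indicator ?B \<omega> *\<^sub>R iexp (\<theta> * X \<omega>)))"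
    by (rule integral_norm_bound)
  also have "\<dots> = 1 - p 0 - p 1" by (simp add: B)
  finally have 1: "norm (expectation (\<lambda>\<omega>. indicator ?B \<omega> *\<^sub>R iexp (\<theta> * X \<omega>))) \<le> 1 - p 0 - p 1" .
  have "(norm (p 0 + p 1 * iexp \<theta>))\<^sup>2 = (p 0 + p 1)\<^sup>2 - 2 * d"
  proof -
    have "(norm (p 0 + p 1 * iexp \<theta>))\<^sup>2 = (p 0 + p 1 * cos \<theta>)\<^sup>2 + (p 1 * sin \<theta>)\<^sup>2"
      by (simp add: cmod_power2 Re_exp Im_exp)
    also have "\<dots> = (p 0)\<^sup>2 + 2 * p 0 * p 1 * cos \<theta> + (p 1)\<^sup>2 * ((sin \<theta>)\<^sup>2 + (cos \<theta>)\<^sup>2)"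
      by (simp only: power_mult_distrib power2_sum distrib_left)
    also have "\<dots> = (p 0 + p 1)\<^sup>2 - 2 * d"
      by (simp add: d_def power2_eq_square algebra_simps)
    finally show ?thesis .
  qed
  \<comment> \<open>Since \<open>p 0 + p 1\<close> is at most 1, \<open>2 * d\<close> may be
    replaced by \<open>2 * ((p 0 + p 1) * d)\<close>; adding \<open>d\<^sup>2\<close> completes the
    square.\<close>
  also have "\<dots> \<le> (p 0 + p 1 - d)\<^sup>2"
  proof -
    have "(p 0 + p 1) * d \<le> d" using p d by (simp add: mult_left_le_one_le)
    moreover have "(p 0 + p 1 - d)\<^sup>2 = (p 0 + p 1)\<^sup>2 - 2 * ((p 0 + p 1) * d) + d\<^sup>2"
      by (simp only: power2_eq_square) (simp add: algebra_simps)
    ultimately show ?thesis using zero_le_power2[of d] by linarith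
  qed
  finally have "norm (p 0 + p 1 * iexp \<theta>) \<le> p 0 + p 1 - d"
    by (rule power2_le_imp_le) (use d2 in simp)
  with 1 show ?thesis
    unfolding split d_def[symmetric]
    using norm_triangle_ineq[of "p 0 + p 1 * iexp \<theta>" "expectation (\<lambda>\<omega>. indicator ?B \<omega> *\<^sub>R iexp (\<theta> * X \<omega>))"]
    by linarith
qed

text \<open>As \<open>G\<close> is centred, the first-order term in \<open>\<tau>\<close> is the expectation of
  \<open>(iexp (\<theta> X) - 1) G\<close>, so it costs a factor \<open>\<bar>\<theta>\<bar>\<close> and can be absorbed by AM-GM.\<close>

lemma norm_expectation_iexp_joint_le:
  fixes X :: "'a \<Rightarrow> nat" and G :: "'a \<Rightarrow> real" and \<tau> \<theta> :: real
  assumes [measurable]: "X \<in> M \<rightarrow>\<^sub>M count_space UNIV" "random_variable borel G"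
    and X2: "integrable M (\<lambda>\<omega>. (real (X \<omega>))\<^sup>2)"
    and G2: "integrable M (\<lambda>\<omega>. (G \<omega>)\<^sup>2)" and mean: "expectation G = 0"
    and var: "expectation (\<lambda>\<omega>. (G \<omega>)\<^sup>2) = 1" and a: "a > 0"
  defines "p \<equiv> \<lambda>k. prob {\<omega> \<in> space M. X \<omega> = k}"
  shows "norm (expectation (\<lambda>\<omega>. iexp (\<tau> * G \<omega> + \<theta> * X \<omega>))) \<le>
    1 - p 0 * p 1 * (1 - cos \<theta>) + a * \<theta>\<^sup>2 * expectation (\<lambda>\<omega>. (real (X \<omega>))\<^sup>2) / 2
      + (1 / (2 * a) + 1 / 2) * \<tau>\<^sup>2"
proof -
  have G1: "integrable M G" by (rule square_integrable_imp_integrable[OF _ G2]) simp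
  \<comment> \<open>\<open>R\<close> is what is left after removing the unperturbed exponential and
    the linear term, whose mean is 0; \<open>h\<close> is an integrable bound for it.\<close>
  define R where "R \<omega> = iexp (\<tau> * G \<omega> + \<theta> * X \<omega>) - iexp (\<theta> * X \<omega>) - \<i> * \<tau> * G \<omega>" for \<omega>
  define h where "h \<omega> = a * \<theta>\<^sup>2 / 2 * (real (X \<omega>))\<^sup>2 + (1 / (2 * a) + 1 / 2) * \<tau>\<^sup>2 * (G \<omega>)\<^sup>2" for \<omega>
  have R: "norm (R \<omega>) \<le> h \<omega>" for \<omega>
  proof -
    let ?x = "\<theta> * X \<omega>" and ?y = "\<tau> * G \<omega>"
    have "R \<omega> = iexp ?x * (iexp ?y - 1 - \<i> * ?y) + (iexp ?x - 1) * (\<i> * ?y)"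
      unfolding R_def iexp_add by (simp add: algebra_simps)
    then have "norm (R \<omega>) \<le> norm (iexp ?y - 1 - \<i> * ?y) + norm (iexp ?x - 1) * \<bar>?y\<bar>"
      by (auto simp: norm_mult abs_mult intro!: order_trans[OF norm_triangle_ineq])
    also have "norm (iexp ?y - 1 - \<i> * ?y) \<le> ?y\<^sup>2 / 2"
      using iexp_approx1[of ?y 1] by (simp add: eval_nat_numeral algebra_simps power2_eq_square abs_mult)
    also have "norm (iexp ?x - 1) \<le> \<bar>?x\<bar>"
      using iexp_approx1[of ?x 0] by simp
    \<comment> \<open>The weight \<open>a\<close> stays free here, so that the loss in \<theta>^2
      can later be made smaller than the gain from the cosine.\<close>
    also have "\<bar>?x\<bar> * \<bar>?y\<bar> \<le> a * ?x\<^sup>2 / 2 + ?y\<^sup>2 / (2 * a)"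
    proof -
      have "0 \<le> (a * \<bar>?x\<bar> - \<bar>?y\<bar>)\<^sup>2 / (2 * a)" using a by simp
      also have "\<dots> = a * \<bar>?x\<bar>\<^sup>2 / 2 + \<bar>?y\<bar>\<^sup>2 / (2 * a) - \<bar>?x\<bar> * \<bar>?y\<bar>"
        using a by (simp only: power2_eq_square) (simp add: field_simps)
      finally show ?thesis by simp
    qed
    finally show ?thesis by (simp add: h_def algebra_simps power_mult_distrib mult_right_mono)
  qed
  have hI: "integrable M h" unfolding h_def using X2 G2 by simp
  have [measurable]: "random_variable borel R" unfolding R_def by simp
  have RI: "integrable M R"
    by (rule Bochner_Integration.integrable_bound[OF hI])
       (use R in \<open>auto intro: order_trans[OF _ abs_ge_self]\<close>)
  have "expectation (\<lambda>\<omega>. iexp (\<tau> * G \<omega> + \<theta> * X \<omega>)) =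
      expectation (\<lambda>\<omega>. R \<omega> + (iexp (\<theta> * X \<omega>) + \<i> * \<tau> * complex_of_real (G \<omega>)))"
    by (simp add: R_def)
  also have "\<dots> = expectation R + expectation (\<lambda>\<omega>. iexp (\<theta> * X \<omega>))"
  proof -
    have "integrable M (\<lambda>\<omega>. iexp (\<theta> * X \<omega>))"
      by (rule integrable_iexp_comp) simp
    moreover have "integrable M (\<lambda>\<omega>. \<i> * \<tau> * complex_of_real (G \<omega>))"
      using G1 by (intro integrable_mult_right) simp
    moreover have "expectation (\<lambda>\<omega>. \<i> * \<tau> * complex_of_real (G \<omega>)) = 0"
      using mean by simp
    ultimately show ?thesis
      using RI by (subst Bochner_Integration.integral_add, simp_all)+ 
  qed
  finally have "norm (expectation (\<lambda>\<omega>. iexp (\<tau> * G \<omega> + \<theta> * X \<omega>))) \<le>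
      norm (expectation R) + norm (expectation (\<lambda>\<omega>. iexp (\<theta> * X \<omega>)))"
    by (simp add: norm_triangle_ineq)
  also have "norm (expectation R) \<le> expectation h"
    by (rule order_trans[OF integral_norm_bound]) (use RI hI R in \<open>auto intro!: integral_mono\<close>)
  also have "expectation h = a * \<theta>\<^sup>2 * expectation (\<lambda>\<omega>. (real (X \<omega>))\<^sup>2) / 2
      + (1 / (2 * a) + 1 / 2) * \<tau>\<^sup>2"
    unfolding h_def using X2 G2 var by simp
  also have "norm (expectation (\<lambda>\<omega>. iexp (\<theta> * X \<omega>))) \<le> 1 - p 0 * p 1 * (1 - cos \<theta>)"
    unfolding p_def by (rule norm_expectation_iexp_nat_le) simp
  finally show ?thesis by simp
qed

text \<open>Fubini moves the integral over the frequency \<open>v\<close> inside, where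
  orthogonality of characters annihilates every value of \<open>K\<close> except 0.\<close>

lemma fourier_inversion_lattice:
  fixes Z :: "'a \<Rightarrow> real" and K :: "'a \<Rightarrow> int"
  assumes [measurable]: "random_variable borel Z" "K \<in> M \<rightarrow>\<^sub>M count_space UNIV" and b: "b > 0"
  shows "(LINT v|lborel. indicator {- (pi * b)..pi * b} v *\<^sub>R expectation (\<lambda>\<omega>. iexp (Z \<omega> + v / b * K \<omega>))) =
    2 * pi * b * expectation (\<lambda>\<omega>. indicator {\<omega> \<in> space M. K \<omega> = 0} \<omega> *\<^sub>R iexp (Z \<omega>))"
proof -
  interpret pair_sigma_finite M lborel ..
  let ?I = "{- (pi * b)..pi * b}"
  let ?f = "\<lambda>\<omega> v. indicator ?I v *\<^sub>R iexp (Z \<omega> + v / b * K \<omega>)"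
  \<comment> \<open>The integrand has modulus 1 on a rectangle of finite measure, whose indicator
    serves as the bound for Fubini.\<close>
  have "integrable (M \<Otimes>\<^sub>M lborel) (\<lambda>x. indicator (space M \<times> ?I) x :: real)"
    by (rule integrable_real_indicator)
       (use b in \<open>auto simp: lborel.emeasure_pair_measure_Times emeasure_space_1\<close>)
  then have "integrable (M \<Otimes>\<^sub>M lborel) (\<lambda>(\<omega>, v). ?f \<omega> v)"
  proof (rule Bochner_Integration.integrable_bound)
    show "AE x in M \<Otimes>\<^sub>M lborel. norm (case x of (\<omega>, v) \<Rightarrow> ?f \<omega> v) \<le> norm (indicator (space M \<times> ?I) x :: real)"
      by (rule AE_I2) (auto simp: space_pair_measure indicator_def)
  qed simp
  then have "(LINT v|lborel. expectation (\<lambda>\<omega>. ?f \<omega> v)) = expectation (\<lambda>\<omega>. LINT v|lborel. ?f \<omega> v)"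
    by (rule Fubini_integral)
  also have "\<dots> = expectation (\<lambda>\<omega>. 2 * pi * b * (indicator {\<omega> \<in> space M. K \<omega> = 0} \<omega> *\<^sub>R iexp (Z \<omega>)))"
  proof (rule Bochner_Integration.integral_cong[OF refl])
    fix \<omega> assume "\<omega> \<in> space M"
    have "(LINT v|lborel. ?f \<omega> v) = (LINT v|lborel. iexp (Z \<omega>) * (indicator ?I v *\<^sub>R iexp (v / b * K \<omega>)))"
      by (simp only: iexp_add mult_scaleR_right)
    also have "\<dots> = iexp (Z \<omega>) * (LINT v|lborel. indicator ?I v *\<^sub>R iexp (v / b * K \<omega>))"
      by (rule integral_mult_right_zero)
    finally show "(LINT v|lborel. ?f \<omega> v) =
        2 * pi * b * (indicator {\<omega> \<in> space M. K \<omega> = 0} \<omega> *\<^sub>R iexp (Z \<omega>))"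
      using \<open>\<omega> \<in> space M\<close> unfolding integral_iexp_lattice[OF b] by (simp add: indicator_def)
  qed
  also have "\<dots> = 2 * pi * b * expectation (\<lambda>\<omega>. indicator {\<omega> \<in> space M. K \<omega> = 0} \<omega> *\<^sub>R iexp (Z \<omega>))"
    by (rule integral_mult_right_zero)
  finally show ?thesis by (simp only: scaleR_scaleR mult_scaleR_right integral_scaleR_right Bochner_Integration.integral_scaleR_right)
qed

end

lemma add_cube_le:
  fixes a b :: real
  assumes "0 \<le> a" "0 \<le> b"
  shows "(a + b) ^ 3 \<le> 4 * (a ^ 3 + b ^ 3)"
proof -
  have "0 \<le> 3 * (a + b) * (a - b)\<^sup>2" using assms by simp
  also have "\<dots> = 4 * (a ^ 3 + b ^ 3) - (a + b) ^ 3"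
    by (simp add: power2_eq_square power3_eq_cube algebra_simps)
  finally show ?thesis by simp
qed

section \<open>Gaussian domination and Gaussian limit for the standardised pair\<close>

context mixed_poisson
begin

abbreviation std :: real where "std \<equiv> sqrt (variance (\<lambda>\<omega>. real (X \<omega>)))"

text \<open>The atoms at 0 and 1 and the factor 1/18 of the cosine bound give a gain of
  \<open>2 * decay * rate * \<theta>\<^sup>2\<close>. One half of it pays for the perturbation by
  \<open>G\<close>, the other half survives.\<close>

definition decay :: real where "decay = exp (- 2 * C) / 36"

lemma decay_pos: "decay > 0" by (simp add: decay_def)

lemma rate_le_std_power2: "rate \<le> std\<^sup>2"
  using variance_X_ge rate_nonneg by simp

lemma std_power2_le: "std\<^sup>2 \<le> (C + 1) * rate"
  using variance_X_le variance_X_ge rate_nonneg by simp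

lemma std_pos: "rate > 0 \<Longrightarrow> std > 0"
  using variance_X_ge by simp

context
  fixes G :: "'a \<Rightarrow> real"
  assumes G_meas [measurable]: "random_variable borel G"
    and G3: "integrable M (\<lambda>\<omega>. \<bar>G \<omega>\<bar> ^ 3)"
    and G_mean: "expectation G = 0" and G_var: "expectation (\<lambda>\<omega>. (G \<omega>)\<^sup>2) = 1"
begin

text \<open>Centring by \<open>rate\<close> only contributes a factor of modulus 1, so the joint
  estimate applies with the mass bounds for 0 and 1 and the second moment bound for
  \<open>X\<close>.\<close>

lemma norm_cf_le:
  assumes "\<bar>\<theta>\<bar> \<le> pi"
  shows "norm (expectation (\<lambda>\<omega>. iexp (\<tau> * G \<omega> + \<theta> * (real (X \<omega>) - rate)))) \<le>
    1 - decay * rate * \<theta>\<^sup>2 + ((C + 1) / (4 * decay) + 1 / 2) * \<tau>\<^sup>2"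
proof -
  \<comment> \<open>With E X^2 at most \<open>(C + 1) * rate\<close>, this weight makes the AM-GM
    loss in \<theta>^2 at most \<open>decay * rate * \<theta>\<^sup>2\<close>.\<close>
  define a where "a = 2 * decay / (C + 1)"
  have C: "C + 1 > 0" using C_nonneg by simp
  have a: "a > 0" using decay_pos C by (simp add: a_def)
  let ?p = "\<lambda>k. prob {\<omega> \<in> space M. X \<omega> = k}"
  have "iexp (\<tau> * G \<omega> + \<theta> * (real (X \<omega>) - rate)) = iexp (- \<theta> * rate) * iexp (\<tau> * G \<omega> + \<theta> * X \<omega>)" for \<omega>
    unfolding iexp_add[symmetric] by (simp add: algebra_simps)
  then have "norm (expectation (\<lambda>\<omega>. iexp (\<tau> * G \<omega> + \<theta> * (real (X \<omega>) - rate)))) =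
      norm (expectation (\<lambda>\<omega>. iexp (\<tau> * G \<omega> + \<theta> * X \<omega>)))"
    by (simp only: integral_mult_right_zero norm_mult norm_exp_i_times)
  also have "\<dots> \<le> 1 - ?p 0 * ?p 1 * (1 - cos \<theta>) + a * \<theta>\<^sup>2 * expectation (\<lambda>\<omega>. (real (X \<omega>))\<^sup>2) / 2
      + (1 / (2 * a) + 1 / 2) * \<tau>\<^sup>2"
    by (rule norm_expectation_iexp_joint_le)
       (use integrable_lower_powers[OF G_meas G3] G_mean G_var a in auto)
  also have "1 / (2 * a) = (C + 1) / (4 * decay)" using C decay_pos by (simp add: a_def)
  also have "a * \<theta>\<^sup>2 * expectation (\<lambda>\<omega>. (real (X \<omega>))\<^sup>2) / 2 \<le> a * \<theta>\<^sup>2 * ((C + 1) * rate) / 2"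
    by (intro divide_right_mono mult_left_mono expectation_X2_le) (use a in auto)
  also have "\<dots> = decay * rate * \<theta>\<^sup>2" using C by (simp add: a_def field_simps)
  finally have "norm (expectation (\<lambda>\<omega>. iexp (\<tau> * G \<omega> + \<theta> * (real (X \<omega>) - rate)))) \<le>
      1 - ?p 0 * ?p 1 * (1 - cos \<theta>) + decay * rate * \<theta>\<^sup>2 + ((C + 1) / (4 * decay) + 1 / 2) * \<tau>\<^sup>2"
    by simp
  moreover have "2 * decay * rate * \<theta>\<^sup>2 \<le> ?p 0 * ?p 1 * (1 - cos \<theta>)"
  proof -
    have "(exp (- C) * (rate * exp (- C))) * (\<theta>\<^sup>2 / 18) \<le> (?p 0 * ?p 1) * (1 - cos \<theta>)"
      by (intro mult_mono prob_X_eq_0_ge prob_X_eq_1_ge cos_le_one_minus_square assms)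
         (use rate_nonneg in auto)
    also have "exp (- C) * (rate * exp (- C)) = 36 * decay * rate"
      by (simp add: decay_def mult.left_commute flip: exp_add)
    finally show ?thesis by (simp add: mult.assoc mult.left_commute)
  qed
  ultimately show ?thesis by linarith
qed

text \<open>The dominating function for the inversion integral. The range of \<open>v\<close> keeps
  the frequency \<theta> within [-pi, pi]; 1 + x is at most exp x; and since
  \<open>rate / std\<^sup>2\<close> is at least 1/(C + 1), the result is free of \<open>N\<close>
  and \<open>rate\<close>.\<close>

lemma norm_cf_power_le:
  fixes N :: nat
  assumes N: "N > 0" and r: "rate > 0" and v: "\<bar>v\<bar> \<le> pi * (std * sqrt N)"
  shows "norm (expectation (\<lambda>\<omega>. iexp ((t * G \<omega> + v * ((real (X \<omega>) - rate) / std)) / sqrt N)) ^ N)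
    \<le> exp (((C + 1) / (4 * decay) + 1 / 2) * t\<^sup>2 - decay / (C + 1) * v\<^sup>2)"
proof -
  note s = std_pos[OF r]
  have C: "C + 1 > 0" using C_nonneg by simp
  define B where "B = (C + 1) / (4 * decay) + 1 / 2"
  define \<tau> where "\<tau> = t / sqrt N"
  define \<theta> where "\<theta> = v / (std * sqrt N)"
  define \<phi> where "\<phi> = expectation (\<lambda>\<omega>. iexp ((t * G \<omega> + v * ((real (X \<omega>) - rate) / std)) / sqrt N))"
  define x where "x = B * \<tau>\<^sup>2 - decay * rate * \<theta>\<^sup>2"
  have \<phi>: "\<phi> = expectation (\<lambda>\<omega>. iexp (\<tau> * G \<omega> + \<theta> * (real (X \<omega>) - rate)))"
    by (simp add: \<phi>_def \<tau>_def \<theta>_def add_divide_distrib)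
  have "\<bar>\<theta>\<bar> \<le> pi"
    using v s N by (simp add: \<theta>_def abs_mult divide_le_eq)
  from norm_cf_le[OF this, of \<tau>] have "norm \<phi> \<le> 1 + x"
    by (simp add: \<phi> B_def x_def)
  also have "\<dots> \<le> exp x" by (rule exp_ge_add_one_self)
  finally have "norm (\<phi> ^ N) \<le> exp x ^ N"
    unfolding norm_power by (intro power_mono) auto
  also have "\<dots> = exp (N * x)" by (simp add: exp_of_nat_mult)
  also have "N * x \<le> B * t\<^sup>2 - decay / (C + 1) * v\<^sup>2"
  proof -
    have "1 / (C + 1) \<le> rate / std\<^sup>2"
      using std_power2_le C s by (simp add: field_simps)
    then have "decay * v\<^sup>2 * (1 / (C + 1)) \<le> decay * v\<^sup>2 * (rate / std\<^sup>2)"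
      using decay_pos by (intro mult_left_mono) auto
    then have "decay / (C + 1) * v\<^sup>2 \<le> N * (decay * rate * \<theta>\<^sup>2)"
      using N by (simp add: \<theta>_def power_divide power_mult_distrib field_simps)
    moreover have "N * x = B * t\<^sup>2 - N * (decay * rate * \<theta>\<^sup>2)"
      using N by (simp add: x_def \<tau>_def power_divide right_diff_distrib)
    ultimately show ?thesis by linarith
  qed
  finally show ?thesis by (simp add: \<phi>_def B_def)
qed

text \<open>The quantitative central limit theorem for \<open>t * G + v * H\<close>, where
  \<open>H\<close> is the standardised \<open>X\<close>, so that \<rho> is the correlation of
  \<open>G\<close> and \<open>X\<close>. The factor 2/3 is the 4 of \<open>add_cube_le\<close> over
  6. The third moment of \<open>H\<close> is at most a constant over \<open>sqrt rate\<close>,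
  whence the term in \<open>sqrt (N * rate)\<close>.\<close>

lemma norm_cf_power_diff_le:
  fixes N :: nat
  assumes N: "N > 0" and r: "rate > 0"
  defines "\<rho> \<equiv> expectation (\<lambda>\<omega>. G \<omega> * ((real (X \<omega>) - rate) / std))"
  shows "norm (expectation (\<lambda>\<omega>. iexp ((t * G \<omega> + v * ((real (X \<omega>) - rate) / std)) / sqrt N)) ^ N
      - complex_of_real (exp (- (t\<^sup>2 + v\<^sup>2 + 2 * t * v * \<rho>) / 2)))
    \<le> 2 / 3 * (\<bar>t\<bar> ^ 3 * (expectation (\<lambda>\<omega>. \<bar>G \<omega>\<bar> ^ 3) / sqrt N)
        + \<bar>v\<bar> ^ 3 * ((2 * C\<^sup>2 + 3 * C + 1) / sqrt (N * rate)))
      + (t\<^sup>2 + v\<^sup>2 + 2 * t * v * \<rho>)\<^sup>2 / (4 * N)"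
proof -
  note s = std_pos[OF r]
  note G12 = integrable_lower_powers[OF G_meas G3]
  define H where "H \<omega> = (real (X \<omega>) - rate) / std" for \<omega>
  have [measurable]: "random_variable borel H" unfolding H_def by measurable
  have H3: "integrable M (\<lambda>\<omega>. \<bar>H \<omega>\<bar> ^ 3)"
    unfolding H_def abs_divide power_divide using integrable_third_central_moment by simp
  note H12 = integrable_lower_powers[OF _ H3]
  have H_mean: "expectation H = 0"
    unfolding H_def by (simp add: prob_space expectation_X)
  have H_var: "expectation (\<lambda>\<omega>. (H \<omega>)\<^sup>2) = 1"
    using s by (simp add: H_def power_divide expectation_X)
  define K where "K = 2 * C\<^sup>2 + 3 * C + 1"
  have K: "K \<ge> 0" using C_nonneg by (simp add: K_def)
  have H3_le: "expectation (\<lambda>\<omega>. \<bar>H \<omega>\<bar> ^ 3) / sqrt N \<le> K / sqrt (N * rate)"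
  proof -
    have "sqrt rate \<le> std" using variance_X_ge by simp
    then have "sqrt rate * rate \<le> std * std\<^sup>2"
      using rate_le_std_power2 s r by (intro mult_mono) auto
    then have sr: "sqrt rate * rate \<le> std ^ 3"
      by (simp only: power3_eq_cube power2_eq_square mult.assoc)
    have "expectation (\<lambda>\<omega>. \<bar>H \<omega>\<bar> ^ 3) = expectation (\<lambda>\<omega>. \<bar>real (X \<omega>) - rate\<bar> ^ 3) / std ^ 3"
      using s by (simp add: H_def abs_divide power_divide)
    also have "\<dots> \<le> K * rate / std ^ 3"
      using third_central_moment_le s by (intro divide_right_mono) (auto simp: K_def algebra_simps)
    also have "\<dots> \<le> K * rate / (sqrt rate * rate)"
      using sr K r s by (intro divide_left_mono) auto
    also have "\<dots> = K / sqrt rate" using r by simp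
    finally have "expectation (\<lambda>\<omega>. \<bar>H \<omega>\<bar> ^ 3) / sqrt N \<le> K / sqrt rate / sqrt N"
      by (rule divide_right_mono) simp
    then show ?thesis by (simp add: real_sqrt_mult mult.commute)
  qed
  have GH: "integrable M (\<lambda>\<omega>. G \<omega> * H \<omega>)"
  proof (rule Bochner_Integration.integrable_bound[of _ "\<lambda>\<omega>. (G \<omega>)\<^sup>2 + (H \<omega>)\<^sup>2"])
    have "\<bar>x * y\<bar> \<le> x\<^sup>2 + y\<^sup>2" for x y :: real
      using sum_squares_bound[of "\<bar>x\<bar>" "\<bar>y\<bar>"] abs_ge_zero[of "x * y"]
      unfolding abs_mult power2_abs mult.assoc by linarith
    then show "AE \<omega> in M. norm (G \<omega> * H \<omega>) \<le> norm ((G \<omega>)\<^sup>2 + (H \<omega>)\<^sup>2)" by simp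
  qed (use G12 H12 in auto)
  define W where "W \<omega> = t * G \<omega> + v * H \<omega>" for \<omega>
  have [measurable]: "random_variable borel W" unfolding W_def by measurable
  have W3: "\<bar>W \<omega>\<bar> ^ 3 \<le> 4 * (\<bar>t\<bar> ^ 3 * \<bar>G \<omega>\<bar> ^ 3 + \<bar>v\<bar> ^ 3 * \<bar>H \<omega>\<bar> ^ 3)" for \<omega>
  proof -
    have "\<bar>W \<omega>\<bar> ^ 3 \<le> (\<bar>t * G \<omega>\<bar> + \<bar>v * H \<omega>\<bar>) ^ 3"
      by (rule power_mono) (auto simp: W_def)
    also have "\<dots> \<le> 4 * (\<bar>t * G \<omega>\<bar> ^ 3 + \<bar>v * H \<omega>\<bar> ^ 3)"
      by (rule add_cube_le) auto
    finally show ?thesis by (simp add: abs_mult power_mult_distrib)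
  qed
  have W3I: "integrable M (\<lambda>\<omega>. \<bar>W \<omega>\<bar> ^ 3)"
    by (rule Bochner_Integration.integrable_bound[of _ "\<lambda>\<omega>. 4 * (\<bar>t\<bar> ^ 3 * \<bar>G \<omega>\<bar> ^ 3 + \<bar>v\<bar> ^ 3 * \<bar>H \<omega>\<bar> ^ 3)"])
       (use G3 H3 W3 in auto)
  have "expectation (\<lambda>\<omega>. \<bar>W \<omega>\<bar> ^ 3) \<le> expectation (\<lambda>\<omega>. 4 * (\<bar>t\<bar> ^ 3 * \<bar>G \<omega>\<bar> ^ 3 + \<bar>v\<bar> ^ 3 * \<bar>H \<omega>\<bar> ^ 3))"
    by (rule integral_mono) (use G3 H3 W3 W3I in auto)
  also have "\<dots> = 4 * (\<bar>t\<bar> ^ 3 * expectation (\<lambda>\<omega>. \<bar>G \<omega>\<bar> ^ 3) + \<bar>v\<bar> ^ 3 * expectation (\<lambda>\<omega>. \<bar>H \<omega>\<bar> ^ 3))"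
    using G3 H3 by simp
  finally have "expectation (\<lambda>\<omega>. \<bar>W \<omega>\<bar> ^ 3) / (6 * sqrt N) \<le>
      4 * (\<bar>t\<bar> ^ 3 * expectation (\<lambda>\<omega>. \<bar>G \<omega>\<bar> ^ 3) + \<bar>v\<bar> ^ 3 * expectation (\<lambda>\<omega>. \<bar>H \<omega>\<bar> ^ 3)) / (6 * sqrt N)"
    by (rule divide_right_mono) simp
  also have "\<dots> = 2 / 3 * (\<bar>t\<bar> ^ 3 * (expectation (\<lambda>\<omega>. \<bar>G \<omega>\<bar> ^ 3) / sqrt N) + \<bar>v\<bar> ^ 3 * (expectation (\<lambda>\<omega>. \<bar>H \<omega>\<bar> ^ 3) / sqrt N))"
    using N by (simp add: field_simps)
  also have "\<dots> \<le> 2 / 3 * (\<bar>t\<bar> ^ 3 * (expectation (\<lambda>\<omega>. \<bar>G \<omega>\<bar> ^ 3) / sqrt N) + \<bar>v\<bar> ^ 3 * (K / sqrt (N * rate)))"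
    by (intro mult_left_mono add_left_mono H3_le) auto
  finally have third: "expectation (\<lambda>\<omega>. \<bar>W \<omega>\<bar> ^ 3) / (6 * sqrt N) \<le>
    2 / 3 * (\<bar>t\<bar> ^ 3 * (expectation (\<lambda>\<omega>. \<bar>G \<omega>\<bar> ^ 3) / sqrt N) + \<bar>v\<bar> ^ 3 * (K / sqrt (N * rate)))" .
  have W_mean: "expectation W = 0"
    unfolding W_def using G12 H12 G_mean H_mean by simp
  have "expectation (\<lambda>\<omega>. (W \<omega>)\<^sup>2) =
      expectation (\<lambda>\<omega>. t\<^sup>2 * (G \<omega>)\<^sup>2 + v\<^sup>2 * (H \<omega>)\<^sup>2 + 2 * t * v * (G \<omega> * H \<omega>))"
    by (intro Bochner_Integration.integral_cong) (auto simp: W_def power2_eq_square algebra_simps)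
  also have "\<dots> = t\<^sup>2 + v\<^sup>2 + 2 * t * v * \<rho>"
    using G12 H12 GH G_var H_var by (simp add: \<rho>_def flip: H_def)
  finally have W2: "expectation (\<lambda>\<omega>. (W \<omega>)\<^sup>2) = t\<^sup>2 + v\<^sup>2 + 2 * t * v * \<rho>" .
  have diff: "norm (expectation (\<lambda>\<omega>. iexp (W \<omega> / sqrt N)) ^ N - exp (- (t\<^sup>2 + v\<^sup>2 + 2 * t * v * \<rho>) / 2)) \<le>
      expectation (\<lambda>\<omega>. \<bar>W \<omega>\<bar> ^ 3) / (6 * sqrt N) + (t\<^sup>2 + v\<^sup>2 + 2 * t * v * \<rho>)\<^sup>2 / (4 * N)"
    using norm_expectation_iexp_power_diff_le[OF _ W3I W_mean N] by (simp only: W2) simp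
  show ?thesis
    using order_trans[OF diff add_right_mono[OF third]] unfolding W_def H_def K_def .
qed

end

end

section \<open>Sums conditioned on a lattice sum\<close>

lemma integrable_exp_neg_square:
  fixes c :: real
  assumes c: "c > 0"
  shows "integrable lborel (\<lambda>v. exp (- (c * v\<^sup>2)))"
proof -
  define \<sigma> where "\<sigma> = 1 / sqrt (2 * c)"
  have "exp (- (c * v\<^sup>2)) = sqrt (2 * pi * \<sigma>\<^sup>2) * normal_density 0 \<sigma> v" for v
    using c by (simp add: normal_density_def \<sigma>_def power_divide mult.commute)
  moreover have "integrable lborel (\<lambda>v. sqrt (2 * pi * \<sigma>\<^sup>2) * normal_density 0 \<sigma> v)"
    using c by (intro integrable_mult_right integrable_normal_density) (simp add: \<sigma>_def)
  ultimately show ?thesis by simp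
qed

lemma integral_exp_neg_half_square: "(LINT v|lborel. exp (- v\<^sup>2 / 2)) = sqrt (2 * pi)"
proof -
  have "exp (- v\<^sup>2 / 2) = sqrt (2 * pi) * std_normal_density v" for v :: real
    by (simp add: std_normal_density_def)
  then show ?thesis by simp
qed

text \<open>Dominated convergence. The pointwise limit exp(-(t^2 + v^2)/2) factorises, and
  integrating out \<open>v\<close> leaves \<open>sqrt (2 * pi)\<close> times the normal
  characteristic function at \<open>t\<close>.\<close>

lemma tendsto_inversion_integral:
  fixes M :: "nat \<Rightarrow> 'a measure" and D :: "nat \<Rightarrow> real measure" and X :: "nat \<Rightarrow> 'a \<Rightarrow> nat"
    and G :: "nat \<Rightarrow> 'a \<Rightarrow> real" and N :: "nat \<Rightarrow> nat"
    and C t :: real and r s :: "nat \<Rightarrow> real"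
  defines "r \<equiv> \<lambda>k. mixed_poisson.rate (D k)"
    and "s \<equiv> \<lambda>k. sqrt (prob_space.variance (M k) (\<lambda>\<omega>. real (X k \<omega>)))"
  assumes mp: "\<And>k. mixed_poisson (M k) (D k) (X k) C"
    and G: "\<And>k. G k \<in> borel_measurable (M k)"
    and G3: "\<And>k. integrable (M k) (\<lambda>\<omega>. \<bar>G k \<omega>\<bar> ^ 3)"
    and G_mean: "\<And>k. prob_space.expectation (M k) (G k) = 0"
    and G_var: "\<And>k. prob_space.expectation (M k) (\<lambda>\<omega>. (G k \<omega>)\<^sup>2) = 1"
    and N: "\<And>k. N k > 0" and r: "\<And>k. r k > 0"
    and third: "(\<lambda>k. prob_space.expectation (M k) (\<lambda>\<omega>. \<bar>G k \<omega>\<bar> ^ 3) / sqrt (N k)) \<longlonglongrightarrow> 0"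
    and N_top: "filterlim N at_top sequentially"
    and rate_top: "filterlim (\<lambda>k. N k * r k) at_top sequentially"
    and corr: "(\<lambda>k. prob_space.expectation (M k) (\<lambda>\<omega>. G k \<omega> * ((real (X k \<omega>) - r k) / s k))) \<longlonglongrightarrow> 0"
  shows "(\<lambda>k. LINT v|lborel. indicator {- (pi * (s k * sqrt (N k)))..pi * (s k * sqrt (N k))} v *\<^sub>R
      prob_space.expectation (M k)
        (\<lambda>\<omega>. iexp ((t * G k \<omega> + v * ((real (X k \<omega>) - r k) / s k)) / sqrt (N k))) ^ N k)
    \<longlonglongrightarrow> complex_of_real (sqrt (2 * pi) * exp (- t\<^sup>2 / 2))"
proof -
  interpret mixed_poisson "M k" "D k" "X k" C for k by (rule mp)
  have [measurable]: "G k \<in> borel_measurable (M k)" for k by (rule G)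
  define b where "b k = s k * sqrt (N k)" for k
  define \<phi> where "\<phi> k v = expectation k
      (\<lambda>\<omega>. iexp ((t * G k \<omega> + v * ((real (X k \<omega>) - r k) / s k)) / sqrt (N k))) ^ N k" for k v
  \<comment> \<open>\<open>decay\<close> depends on \<open>C\<close> alone, so one Gaussian in
    \<open>v\<close> dominates for all \<open>k\<close>.\<close>
  define c where "c = decay / (C + 1)"
  have c: "c > 0" using decay_pos C_nonneg by (simp add: c_def)
  define B where "B = (C + 1) / (4 * decay) + 1 / 2"
  have dom: "norm (\<phi> k v) \<le> exp (B * t\<^sup>2 - c * v\<^sup>2)" if "\<bar>v\<bar> \<le> pi * b k" for k v
    using norm_cf_power_le[OF G G3 G_mean G_var N r[unfolded r_def], where v = v and t = t] that
    by (simp add: \<phi>_def B_def c_def r_def s_def b_def)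
  \<comment> \<open>For fixed \<open>v\<close> every error term vanishes, and the vanishing
    correlation \<rho> removes the cross term from the quadratic form \<open>q\<close>.\<close>
  have lim: "(\<lambda>k. \<phi> k v) \<longlonglongrightarrow> complex_of_real (exp (- (t\<^sup>2 + v\<^sup>2) / 2))" for v
  proof -
    define \<rho> where "\<rho> k = expectation k (\<lambda>\<omega>. G k \<omega> * ((real (X k \<omega>) - r k) / s k))" for k
    define q where "q k = t\<^sup>2 + v\<^sup>2 + 2 * t * v * \<rho> k" for k
    have "\<rho> \<longlonglongrightarrow> 0" using corr unfolding \<rho>_def .
    then have "q \<longlonglongrightarrow> t\<^sup>2 + v\<^sup>2 + 2 * t * v * 0"
      unfolding q_def by (intro tendsto_intros)
    then have q: "q \<longlonglongrightarrow> t\<^sup>2 + v\<^sup>2" by simp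
    define err where "err k = 2 / 3 * (\<bar>t\<bar> ^ 3 * (expectation k (\<lambda>\<omega>. \<bar>G k \<omega>\<bar> ^ 3) / sqrt (N k))
        + \<bar>v\<bar> ^ 3 * ((2 * C\<^sup>2 + 3 * C + 1) / sqrt (N k * r k))) + (q k)\<^sup>2 / (4 * N k)" for k
    have rN: "(\<lambda>k. (2 * C\<^sup>2 + 3 * C + 1) / sqrt (N k * r k)) \<longlonglongrightarrow> 0"
      by (intro tendsto_divide_0[OF tendsto_const] filterlim_at_top_imp_at_infinity
          filterlim_compose[OF sqrt_at_top rate_top])
    have "filterlim (\<lambda>k. real (4 * N k)) at_top sequentially"
      by (rule filterlim_compose[OF filterlim_real_sequentially])
         (rule filterlim_at_top_mono[OF N_top], simp)
    then have qN: "(\<lambda>k. (q k)\<^sup>2 / (4 * N k)) \<longlonglongrightarrow> 0"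
      by (intro tendsto_divide_0[OF tendsto_power[OF q]] filterlim_at_top_imp_at_infinity)
    have "err \<longlonglongrightarrow> 2 / 3 * (\<bar>t\<bar> ^ 3 * 0 + \<bar>v\<bar> ^ 3 * 0) + 0"
      unfolding err_def by (intro tendsto_intros third rN qN)
    then have err: "err \<longlonglongrightarrow> 0" by simp
    have "norm (\<phi> k v - complex_of_real (exp (- q k / 2))) \<le> err k" for k
      using norm_cf_power_diff_le[OF G G3 G_mean G_var N r[unfolded r_def], where v = v and t = t]
      by (simp only: \<phi>_def err_def r_def s_def q_def \<rho>_def)
    then have "(\<lambda>k. \<phi> k v - complex_of_real (exp (- q k / 2))) \<longlonglongrightarrow> 0"
      by (intro Lim_null_comparison[OF _ err] always_eventually) auto
    moreover have "(\<lambda>k. complex_of_real (exp (- q k / 2))) \<longlonglongrightarrow> complex_of_real (exp (- (t\<^sup>2 + v\<^sup>2) / 2))"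
      by (intro tendsto_intros q) simp
    ultimately show ?thesis by (rule Lim_transform[rotated])
  qed
  \<comment> \<open>As Var X is at least the rate, \<open>b k\<close> is at least
    \<open>sqrt (N k * r k)\<close>, so the integration windows exhaust the real line.\<close>
  have b_top: "filterlim (\<lambda>k. pi * b k) at_top sequentially"
  proof (rule filterlim_at_top_mono)
    show "filterlim (\<lambda>k. sqrt (N k * r k)) at_top sequentially"
      by (rule filterlim_compose[OF sqrt_at_top rate_top])
    have "sqrt (N k * r k) \<le> pi * b k" for k
    proof -
      have "sqrt (N k * r k) = sqrt (r k) * sqrt (N k)" by (simp add: real_sqrt_mult)
      also have "\<dots> \<le> b k"
        unfolding b_def r_def s_def by (intro mult_right_mono real_sqrt_le_mono variance_X_ge) simp
      also have "\<dots> \<le> pi * b k"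
      proof -
        have "0 \<le> b k" by (simp add: b_def s_def)
        then show ?thesis using mult_right_mono[of 1 pi "b k"] pi_ge_two by simp
      qed
      finally show ?thesis .
    qed
    then show "\<forall>\<^sub>F k in sequentially. sqrt (N k * r k) \<le> pi * b k" by simp
  qed
  have "(\<lambda>k. LINT v|lborel. indicator {- (pi * b k)..pi * b k} v *\<^sub>R \<phi> k v)
      \<longlonglongrightarrow> (LINT v|lborel. complex_of_real (exp (- (t\<^sup>2 + v\<^sup>2) / 2)))"
  proof (rule integral_dominated_convergence)
    show "(\<lambda>v. complex_of_real (exp (- (t\<^sup>2 + v\<^sup>2) / 2))) \<in> borel_measurable lborel" by measurable
    show "(\<lambda>v. indicator {- (pi * b k)..pi * b k} v *\<^sub>R \<phi> k v) \<in> borel_measurable lborel" for k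
      unfolding \<phi>_def by measurable
    have "integrable lborel (\<lambda>v. exp (B * t\<^sup>2) * exp (- (c * v\<^sup>2)))"
      by (intro integrable_mult_right integrable_exp_neg_square c)
    then show "integrable lborel (\<lambda>v. exp (B * t\<^sup>2 - c * v\<^sup>2))"
      by (simp flip: exp_add)
    show "AE v in lborel. norm (indicator {- (pi * b k)..pi * b k} v *\<^sub>R \<phi> k v) \<le> exp (B * t\<^sup>2 - c * v\<^sup>2)" for k
      using dom by (auto simp: indicator_def abs_le_iff)
    show "AE v in lborel. (\<lambda>k. indicator {- (pi * b k)..pi * b k} v *\<^sub>R \<phi> k v)
        \<longlonglongrightarrow> complex_of_real (exp (- (t\<^sup>2 + v\<^sup>2) / 2))"
    proof (rule AE_I2)
      fix v :: real
      have "eventually (\<lambda>k. \<bar>v\<bar> \<le> pi * b k) sequentially"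
        using b_top by (simp add: filterlim_at_top)
      then have "eventually (\<lambda>k. \<phi> k v = indicator {- (pi * b k)..pi * b k} v *\<^sub>R \<phi> k v) sequentially"
        by eventually_elim (simp add: indicator_def abs_le_iff)
      with lim show "(\<lambda>k. indicator {- (pi * b k)..pi * b k} v *\<^sub>R \<phi> k v)
          \<longlonglongrightarrow> complex_of_real (exp (- (t\<^sup>2 + v\<^sup>2) / 2))"
        by (rule Lim_transform_eventually)
    qed
  qed
  also have "(LINT v|lborel. complex_of_real (exp (- (t\<^sup>2 + v\<^sup>2) / 2))) =
      complex_of_real (LINT v|lborel. exp (- t\<^sup>2 / 2) * exp (- v\<^sup>2 / 2))"
    unfolding integral_complex_of_real exp_add[symmetric] by (simp add: diff_divide_distrib)
  also have "\<dots> = complex_of_real (sqrt (2 * pi) * exp (- t\<^sup>2 / 2))"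
    unfolding integral_mult_right_zero integral_exp_neg_half_square by (simp only: mult.commute)
  finally show ?thesis unfolding \<phi>_def b_def .
qed

context prob_space
begin

lemma expectation_comp_nat_eq:
  fixes X Y :: "'a \<Rightarrow> nat" and h :: "nat \<Rightarrow> 'b::{banach, second_countable_topology}"
  assumes [measurable]: "X \<in> M \<rightarrow>\<^sub>M count_space UNIV" "Y \<in> M \<rightarrow>\<^sub>M count_space UNIV"
    and law: "\<And>k. prob {\<omega> \<in> space M. X \<omega> = k} = prob {\<omega> \<in> space M. Y \<omega> = k}"
  shows "expectation (\<lambda>\<omega>. h (X \<omega>)) = expectation (\<lambda>\<omega>. h (Y \<omega>))"
    and "integrable M (\<lambda>\<omega>. h (X \<omega>)) \<longleftrightarrow> integrable M (\<lambda>\<omega>. h (Y \<omega>))"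
proof -
  have eq: "distr M (count_space UNIV) X = distr M (count_space UNIV) Y"
  proof (rule measure_eqI_countable[of _ UNIV])
    fix k :: nat
    have "emeasure (distr M (count_space UNIV) Z) {k} = prob {\<omega> \<in> space M. Z \<omega> = k}"
      if [measurable]: "Z \<in> M \<rightarrow>\<^sub>M count_space UNIV" for Z
      by (subst emeasure_distr) (auto simp: emeasure_eq_measure vimage_def Int_def intro!: arg_cong[of _ _ prob])
    then show "emeasure (distr M (count_space UNIV) X) {k} = emeasure (distr M (count_space UNIV) Y) {k}"
      by (simp add: law)
  qed auto
  show "expectation (\<lambda>\<omega>. h (X \<omega>)) = expectation (\<lambda>\<omega>. h (Y \<omega>))"
    using arg_cong[OF eq, of "\<lambda>\<mu>. integral\<^sup>L \<mu> h"] by (simp add: integral_distr)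
  show "integrable M (\<lambda>\<omega>. h (X \<omega>)) \<longleftrightarrow> integrable M (\<lambda>\<omega>. h (Y \<omega>))"
    using arg_cong[OF eq, of "\<lambda>\<mu>. integrable \<mu> h"] by (simp add: integrable_distr_eq)
qed

text \<open>Bienayme's identity for centred summands: each new summand is independent of the partial
  sum, so the cross term has mean 0. Integrability of the square is carried along the induction to
  allow splitting the expanded square.\<close>

lemma expectation_sum_square_indep:
  fixes Y :: "'i \<Rightarrow> 'a \<Rightarrow> real"
  assumes "finite I" and "indep_vars (\<lambda>_. borel) Y I"
    and "\<And>i. i \<in> I \<Longrightarrow> integrable M (\<lambda>\<omega>. (Y i \<omega>)\<^sup>2)" and "\<And>i. i \<in> I \<Longrightarrow> expectation (Y i) = 0"
  shows "integrable M (\<lambda>\<omega>. (\<Sum>i\<in>I. Y i \<omega>)\<^sup>2) \<and>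
    expectation (\<lambda>\<omega>. (\<Sum>i\<in>I. Y i \<omega>)\<^sup>2) = (\<Sum>i\<in>I. expectation (\<lambda>\<omega>. (Y i \<omega>)\<^sup>2))"
  using assms
proof (induction I rule: finite_induct)
  case (insert j I)
  define Z where "Z \<omega> = (\<Sum>i\<in>I. Y i \<omega>)" for \<omega>
  have rv [measurable]: "i \<in> insert j I \<Longrightarrow> random_variable borel (Y i)" for i
    using insert.prems(1) by (auto simp: indep_vars_def)
  have I1: "integrable M (Y i)" if "i \<in> insert j I" for i
    by (rule square_integrable_imp_integrable[OF rv[OF that] insert.prems(2)[OF that]])
  have IH: "integrable M (\<lambda>\<omega>. (Z \<omega>)\<^sup>2)"
    "expectation (\<lambda>\<omega>. (Z \<omega>)\<^sup>2) = (\<Sum>i\<in>I. expectation (\<lambda>\<omega>. (Y i \<omega>)\<^sup>2))"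
    unfolding Z_def using insert.IH insert.prems indep_vars_subset[OF insert.prems(1), of I] by auto
  have ZI: "integrable M Z" and Z0: "expectation Z = 0"
    unfolding Z_def using I1 insert.prems(3) by auto
  have ind: "indep_var borel (Y j) borel Z"
    unfolding Z_def using insert by (intro indep_vars_sum) auto
  have YZ: "integrable M (\<lambda>\<omega>. Y j \<omega> * Z \<omega>)" "expectation (\<lambda>\<omega>. Y j \<omega> * Z \<omega>) = 0"
    using indep_var_integrable[OF ind] indep_var_lebesgue_integral[OF ind] I1[of j] ZI Z0 by auto
  have "(\<Sum>i\<in>insert j I. Y i \<omega>)\<^sup>2 = (Y j \<omega>)\<^sup>2 + 2 * (Y j \<omega> * Z \<omega>) + (Z \<omega>)\<^sup>2" for \<omega>
    using insert.hyps by (simp add: Z_def power2_sum)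
  then show ?case
    using insert.hyps insert.prems(2)[of j] YZ IH by simp
qed simp

text \<open>The Bartlett-Holst formula before normalisation. Independence turns the N-th power into
  the joint characteristic function of both sums, and lattice inversion in \<open>v\<close>
  restricts the expectation to the event that the sum equals \<open>n\<close>.\<close>

lemma conditioned_sum_inversion:
  fixes Xs :: "nat \<Rightarrow> 'a \<Rightarrow> nat" and X :: "'a \<Rightarrow> nat" and N n :: nat and g :: "nat \<Rightarrow> real" and r s t :: real
  assumes indep: "indep_vars (\<lambda>_. count_space UNIV) Xs {1..N}"
    and X [measurable]: "X \<in> M \<rightarrow>\<^sub>M count_space UNIV"
    and law: "\<And>i k. i \<in> {1..N} \<Longrightarrow> prob {\<omega> \<in> space M. Xs i \<omega> = k} = prob {\<omega> \<in> space M. X \<omega> = k}"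
    and N: "N > 0" and s: "s > 0" and r: "N * r = n"
  shows "(LINT v|lborel. indicator {- (pi * (s * sqrt N))..pi * (s * sqrt N)} v *\<^sub>R
      expectation (\<lambda>\<omega>. iexp ((t * g (X \<omega>) + v * ((real (X \<omega>) - r) / s)) / sqrt N)) ^ N) =
    2 * pi * (s * sqrt N) * expectation (\<lambda>\<omega>. indicator {\<omega> \<in> space M. (\<Sum>i=1..N. Xs i \<omega>) = n} \<omega> *\<^sub>R
      iexp (t * ((\<Sum>i=1..N. g (Xs i \<omega>)) / sqrt N)))"
proof -
  have rv [measurable]: "Xs i \<in> M \<rightarrow>\<^sub>M count_space UNIV" if "i \<in> {1..N}" for i
    using indep that by (auto simp: indep_vars_def)
  define b where "b = s * sqrt N"
  have b: "b > 0" using s N by (simp add: b_def)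
  define Z where "Z \<omega> = t * ((\<Sum>i=1..N. g (Xs i \<omega>)) / sqrt N)" for \<omega>
  define K where "K \<omega> = int (\<Sum>i=1..N. Xs i \<omega>) - int n" for \<omega>
  have [measurable]: "random_variable borel Z" "K \<in> M \<rightarrow>\<^sub>M count_space UNIV"
    unfolding Z_def K_def by measurable
  define h where "h v k = iexp ((t * g k + v * ((real k - r) / s)) / sqrt N)" for v k
  have "expectation (\<lambda>\<omega>. h v (X \<omega>)) ^ N = expectation (\<lambda>\<omega>. iexp (Z \<omega> + v / b * K \<omega>))" for v
  proof -
    \<comment> \<open>Because \<open>N * r = n\<close>, the centred counts add up to the integer
      \<open>K\<close>, as lattice inversion requires.\<close>
    have "Z \<omega> + v / b * K \<omega> = (\<Sum>i=1..N. (t * g (Xs i \<omega>) + v * ((real (Xs i \<omega>) - r) / s)) / sqrt N)" for \<omega>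
    proof -
      have "real_of_int (K \<omega>) = (\<Sum>i=1..N. real (Xs i \<omega>) - r)"
        by (simp add: K_def sum_subtractf r)
      then show ?thesis
        by (simp add: Z_def b_def sum.distrib sum_distrib_left sum_divide_distrib add_divide_distrib)
    qed
    then have "iexp (Z \<omega> + v / b * K \<omega>) = (\<Prod>i=1..N. h v (Xs i \<omega>))" for \<omega>
      by (simp only: h_def of_real_sum sum_distrib_left) (simp add: exp_sum)
    then have "expectation (\<lambda>\<omega>. iexp (Z \<omega> + v / b * K \<omega>)) = expectation (\<lambda>\<omega>. \<Prod>i=1..N. h v (Xs i \<omega>))"
      by simp
    also have "\<dots> = (\<Prod>i=1..N. expectation (\<lambda>\<omega>. h v (Xs i \<omega>)))"
    proof (rule indep_vars_lebesgue_integral)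
      show "indep_vars (\<lambda>_. borel) (\<lambda>i \<omega>. h v (Xs i \<omega>)) {1..N}"
        by (rule indep_vars_compose2[OF indep]) simp
      show "integrable M (\<lambda>\<omega>. h v (Xs i \<omega>))" if "i \<in> {1..N}" for i
      proof -
        note [measurable] = rv[OF that]
        show ?thesis unfolding h_def by (intro integrable_iexp_comp) measurable
      qed
    qed simp
    also have "\<dots> = (\<Prod>i=1..N. expectation (\<lambda>\<omega>. h v (X \<omega>)))"
      by (intro prod.cong refl expectation_comp_nat_eq rv X law)
    finally show ?thesis by simp
  qed
  moreover have "{\<omega> \<in> space M. K \<omega> = 0} = {\<omega> \<in> space M. (\<Sum>i=1..N. Xs i \<omega>) = n}"
    by (simp only: K_def right_minus_eq of_nat_eq_iff)
  ultimately show ?thesis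
    using fourier_inversion_lattice[of Z K b] b
    unfolding h_def b_def Z_def by simp
qed

end

text \<open>Only the law of \<open>U\<close> enters a characteristic function, and that law is the
  normalised restriction to \<open>B\<close> pushed forward by \<open>T\<close>.\<close>

lemma char_standardized_cond_law:
  fixes T :: "'a \<Rightarrow> real" and U :: "'b \<Rightarrow> real"
  assumes "prob_space M" "prob_space L" and [measurable]: "T \<in> borel_measurable M" "B \<in> sets M"
    and [measurable]: "U \<in> borel_measurable L" and U: "distr L borel U = cond_law M T B"
  shows "char (distr L borel (\<lambda>\<omega>. (U \<omega> - m) / d)) t =
      (LINT \<omega>|M. indicator B \<omega> *\<^sub>R iexp (t * ((T \<omega> - m) / d))) / measure M B"
proof -
  interpret M: prob_space M by fact
  interpret L: prob_space L by fact
  \<comment> \<open>On a null set \<open>B\<close> the measure \<open>uniform_measure M B\<close>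
    has total mass 0 / 0 = 0, contradicting that \<open>U\<close> has a probability law. The
    conditioning event thus has positive probability because \<open>U\<close> exists.\<close>
  have pos: "measure M B > 0"
  proof (rule ccontr)
    assume "\<not> measure M B > 0"
    then have "emeasure M B = 0"
      using measure_nonneg[of M B] by (simp add: M.emeasure_eq_measure)
    moreover have "emeasure (distr L borel U) UNIV = 1"
      using L.emeasure_space_1 by (subst emeasure_distr) auto
    ultimately show False
      unfolding U cond_law_def
      by (subst (asm) emeasure_distr) (auto simp: emeasure_uniform_measure)
  qed
  \<comment> \<open>Positivity of \<open>measure M B\<close> allows a real-valued density, as
    integration of complex functions against it needs.\<close>
  have um: "uniform_measure M B = density M (\<lambda>\<omega>. ennreal (indicator B \<omega> / measure M B))"
    unfolding uniform_measure_def
    by (intro density_cong) (use pos divide_ennreal[of 1 "measure M B"] in \<open>auto simp: M.emeasure_eq_measure divide_ennreal indicator_def\<close>)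
  have "char (distr L borel (\<lambda>\<omega>. (U \<omega> - m) / d)) t = (LINT x|distr L borel U. iexp (t * ((x - m) / d)))"
    by (simp add: char_def integral_distr)
  also have "\<dots> = (LINT \<omega>|uniform_measure M B. iexp (t * ((T \<omega> - m) / d)))"
    unfolding U cond_law_def by (subst integral_distr) auto
  also have "\<dots> = (LINT \<omega>|M. (indicator B \<omega> / measure M B) *\<^sub>R iexp (t * ((T \<omega> - m) / d)))"
    unfolding um by (subst integral_density) auto
  also have "\<dots> = (LINT \<omega>|M. (indicator B \<omega> *\<^sub>R iexp (t * ((T \<omega> - m) / d))) / measure M B)"
    by (simp add: scaleR_conv_of_real)
  also have "\<dots> = (LINT \<omega>|M. indicator B \<omega> *\<^sub>R iexp (t * ((T \<omega> - m) / d))) / measure M B"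
    by (rule integral_divide_zero)
  finally show ?thesis .
qed

theorem theorem2p3:
  fixes N :: "nat \<Rightarrow> nat"
    and \<pi>1 :: "nat \<Rightarrow> real measure"
    and w :: "nat \<Rightarrow> nat \<Rightarrow> real"
    and M :: "nat \<Rightarrow> 'a measure"
    and Q :: "nat \<Rightarrow> nat \<Rightarrow> 'a \<Rightarrow> real"
    and Ot :: "nat \<Rightarrow> nat \<Rightarrow> 'a \<Rightarrow> nat"
    and L :: "nat \<Rightarrow> 'b measure"
    and U :: "nat \<Rightarrow> 'b \<Rightarrow> real"
  assumes N_pos: "\<And>n. n \<ge> 1 \<Longrightarrow> N n > 0"
    and pi1_prob: "\<And>n. n \<ge> 1 \<Longrightarrow> prob_space (\<pi>1 n)"
    and pi1_sets: "\<And>n. n \<ge> 1 \<Longrightarrow> sets (\<pi>1 n) = sets borel"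
    and pi1_nonneg: "\<And>n. n \<ge> 1 \<Longrightarrow> AE q in \<pi>1 n. q \<in> {0..}"
    and M_prob: "\<And>n. n \<ge> 1 \<Longrightarrow> prob_space (M n)"
    and indep: "\<And>n. n \<ge> 1 \<Longrightarrow>
      prob_space.indep_vars (M n) (\<lambda>i. borel \<Otimes>\<^sub>M count_space UNIV)
        (\<lambda>i \<omega>. (Q n i \<omega>, Ot n i \<omega>)) {1..N n}"
    and Q_law: "\<And>n i. n \<ge> 1 \<Longrightarrow> i \<in> {1..N n} \<Longrightarrow> distr (M n) borel (Q n i) = \<pi>1 n"
    and O_cond_law: "\<And>n i. n \<ge> 1 \<Longrightarrow> i \<in> {1..N n} \<Longrightarrow>
      cond_distributed (M n) (Ot n i) (Q n i) (\<lambda>q. Poi (real n * q))"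
    and L_prob: "\<And>n. n \<ge> 1 \<Longrightarrow> prob_space (L n)"
    and U_rv: "\<And>n. n \<ge> 1 \<Longrightarrow> U n \<in> borel_measurable (L n)"
    and U_law: "\<And>n. n \<ge> 1 \<Longrightarrow>
      distr (L n) borel (U n) =
        cond_law (M n) (T_stat (N n) (w n) (Ot n))
          {\<omega> \<in> space (M n). S_total (N n) (Ot n) \<omega> = n}"
    and N_tendsto: "filterlim N at_top sequentially"
    and N_small: "(\<lambda>n. real (N n)) \<in> o(\<lambda>n. (real n)\<^sup>2)"
    and i: "(\<lambda>n. corr (M n) (\<lambda>\<omega>. real (Ot n 1 \<omega>)) (\<lambda>\<omega>. w n (Ot n 1 \<omega>))) \<in> o(\<lambda>n. 1)"
    and ii_mean: "\<And>n. n \<ge> 1 \<Longrightarrow> prob_space.expectation (M n) (Q n 1) = 1 / real (N n)"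
    and ii_support: "\<exists>C>0. \<forall>n\<ge>1. AE q in \<pi>1 n. q \<in> {0..C / real n}"
    and iii_var: "\<And>n. n \<ge> 1 \<Longrightarrow> prob_space.variance (M n) (\<lambda>\<omega>. w n (Ot n 1 \<omega>)) > 0"
    and iii_mom: "\<And>n. n \<ge> 1 \<Longrightarrow> integrable (M n) (\<lambda>\<omega>. \<bar>w n (Ot n 1 \<omega>)\<bar> ^ 3)"
    and iii_lyapunov:
      "(\<lambda>n. prob_space.expectation (M n)
               (\<lambda>\<omega>. \<bar>w n (Ot n 1 \<omega>) - prob_space.expectation (M n) (\<lambda>\<omega>. w n (Ot n 1 \<omega>))\<bar> ^ 3)
             / (sqrt (real (N n)) *
                prob_space.variance (M n) (\<lambda>\<omega>. w n (Ot n 1 \<omega>)) powr (3 / 2))) \<in> o(\<lambda>n. 1)"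
  shows "(\<lambda>n. SUP x :: real.
            \<bar>\<P>(\<omega> in L n.
                (U n \<omega> - prob_space.expectation (M n) (T_stat (N n) (w n) (Ot n)))
                / sqrt (prob_space.variance (M n) (T_stat (N n) (w n) (Ot n))) \<le> x)
              - Phi x\<bar>) \<longlonglongrightarrow> 0"
proof -
  obtain C where C: "C > 0" "\<And>n. n \<ge> 1 \<Longrightarrow> AE q in \<pi>1 n. q \<in> {0..C / real n}"
    using ii_support by blast
  \<comment> \<open>The assumptions start at index 1, so everything is done along the shifted
    sequence k + 1 and transferred back at the end.\<close>
  define n where "n = Suc"
  have n1: "n k \<ge> 1" and n_pos: "real (n k) > 0" for k by (auto simp: n_def)
  define M' where "M' k = M (n k)" for k
  define N' where "N' k = N (n k)" for k
  define X where "X k = Ot (n k) 1" for k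
  \<comment> \<open>The law of n Q_1; rescaling turns the support bound C/n into the uniform bound
    \<open>C\<close>.\<close>
  define D where "D k = distr (\<pi>1 (n k)) borel (\<lambda>q. real (n k) * q)" for k
  define \<mu> where "\<mu> k = prob_space.expectation (M' k) (\<lambda>\<omega>. w (n k) (X k \<omega>))" for k
  define V where "V k = prob_space.variance (M' k) (\<lambda>\<omega>. w (n k) (X k \<omega>))" for k
  define g where "g k j = (w (n k) j - \<mu> k) / sqrt (V k)" for k j
  define G where "G k \<omega> = g k (X k \<omega>)" for k \<omega>
  define r where "r k = mixed_poisson.rate (D k)" for k
  define s where "s k = sqrt (prob_space.variance (M' k) (\<lambda>\<omega>. real (X k \<omega>)))" for k
  interpret P: prob_space "M' k" for k unfolding M'_def by (rule M_prob[OF n1])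
  interpret pi: prob_space "\<pi>1 (n k)" for k by (rule pi1_prob[OF n1])
  have [measurable_cong]: "sets (\<pi>1 (n k)) = sets borel" for k by (rule pi1_sets[OF n1])
  have N': "N' k > 0" for k unfolding N'_def by (rule N_pos[OF n1])
  then have one: "1 \<in> {1..N' k}" for k by (simp add: Suc_leI)
  have V: "V k > 0" for k
    unfolding V_def M'_def X_def by (rule iii_var[OF n1])
  have cd: "cond_distributed (M' k) (Ot (n k) i) (Q (n k) i) (\<lambda>q. Poi (real (n k) * q))"
    and Q: "distr (M' k) borel (Q (n k) i) = \<pi>1 (n k)" if "i \<in> {1..N' k}" for i k
    using that O_cond_law[OF n1] Q_law[OF n1] by (auto simp: M'_def N'_def)
  have Ot_meas: "Ot (n k) i \<in> M' k \<rightarrow>\<^sub>M count_space UNIV" if "i \<in> {1..N' k}" for i k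
    using cd[OF that] by (simp add: cond_distributed_def)
  have Q_meas: "Q (n k) 1 \<in> borel_measurable (M' k)" for k
    using cd[OF one] by (simp add: cond_distributed_def)
  have [measurable]: "X k \<in> M' k \<rightarrow>\<^sub>M count_space UNIV" for k
    unfolding X_def by (rule Ot_meas[OF one])
  \<comment> \<open>Choosing \<open>A = UNIV\<close> in the conditional distribution leaves the
    mixture of Poisson masses.\<close>
  have law_D: "P.prob k {\<omega> \<in> space (M' k). Ot (n k) i \<omega> = j} = (\<integral>l. pmf (Poi l) j \<partial>D k)"
    if "i \<in> {1..N' k}" for i j k
  proof -
    have "P.prob k {\<omega> \<in> space (M' k). Ot (n k) i \<omega> = j} = (\<integral>q. pmf (Poi (real (n k) * q)) j \<partial>\<pi>1 (n k))"
      using cd[OF that] unfolding cond_distributed_def Q[OF that]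
      by (auto dest!: bspec[of _ _ UNIV] simp: set_lebesgue_integral_def)
    then show ?thesis by (simp add: D_def integral_distr)
  qed
  have law: "P.prob k {\<omega> \<in> space (M' k). Ot (n k) i \<omega> = j} = P.prob k {\<omega> \<in> space (M' k). X k \<omega> = j}"
    if "i \<in> {1..N' k}" for i j k
    using law_D[OF that] law_D[OF one] by (simp add: X_def)
  have mp: "mixed_poisson (M' k) (D k) (X k) C" for k
  proof (intro mixed_poisson.intro mixed_poisson_axioms.intro)
    show "prob_space (D k)" unfolding D_def by (rule pi.prob_space_distr) simp
    have "AE q in \<pi>1 (n k). real (n k) * q \<in> {0..C}"
      using C(2)[OF n1] by eventually_elim (use n_pos[of k] in \<open>auto simp: field_simps\<close>)
    then show "AE l in D k. l \<in> {0..C}" unfolding D_def by (subst AE_distr_iff) auto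
    show "P.prob k {\<omega> \<in> space (M' k). X k \<omega> = j} = (\<integral>l. pmf (Poi l) j \<partial>D k)" for j
      unfolding X_def by (rule law_D[OF one])
  qed (simp_all add: P.prob_space_axioms D_def)
  have r_eq: "r k = real (n k) / real (N' k)" for k
  proof -
    have "(\<integral>q. q \<partial>\<pi>1 (n k)) = P.expectation k (Q (n k) 1)"
      unfolding Q[OF one, symmetric] using Q_meas by (simp add: integral_distr)
    also have "\<dots> = 1 / real (N' k)"
      unfolding M'_def N'_def by (rule ii_mean[OF n1])
    finally show ?thesis
      unfolding r_def mixed_poisson.rate_def[OF mp] unfolding D_def by (simp add: integral_distr)
  qed
  \<comment> \<open>The conditioning value is the mean of the total count, so centring each count by
    \<open>r k\<close> centres the total at \<open>n k\<close>.\<close>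
  have r: "r k > 0" and Nr: "real (N' k) * r k = real (n k)" for k
    using N'[of k] n_pos[of k] by (auto simp: r_eq)
  have s: "s k > 0" for k
    using mixed_poisson.std_pos[OF mp] r by (simp add: r_def s_def)

  \<comment> \<open>Moments of the standardised weight\<close>
  have w3: "integrable (M' k) (\<lambda>\<omega>. \<bar>w (n k) (X k \<omega>)\<bar> ^ 3)" for k
    unfolding M'_def X_def by (rule iii_mom[OF n1])
  note w12 = P.integrable_lower_powers[OF _ w3]
  have G3: "integrable (M' k) (\<lambda>\<omega>. \<bar>G k \<omega>\<bar> ^ 3)"
    and G3_eq: "P.expectation k (\<lambda>\<omega>. \<bar>G k \<omega>\<bar> ^ 3) =
      P.expectation k (\<lambda>\<omega>. \<bar>w (n k) (X k \<omega>) - \<mu> k\<bar> ^ 3) / V k powr (3 / 2)" for k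
  proof -
    have cube: "\<bar>x - y\<bar> ^ 3 \<le> 4 * (\<bar>x\<bar> ^ 3 + \<bar>y\<bar> ^ 3)" for x y :: real
    proof -
      have "\<bar>x - y\<bar> ^ 3 \<le> (\<bar>x\<bar> + \<bar>y\<bar>) ^ 3" by (rule power_mono) auto
      also have "\<dots> \<le> 4 * (\<bar>x\<bar> ^ 3 + \<bar>y\<bar> ^ 3)" by (rule add_cube_le) auto
      finally show ?thesis .
    qed
    have c3: "integrable (M' k) (\<lambda>\<omega>. \<bar>w (n k) (X k \<omega>) - \<mu> k\<bar> ^ 3)"
      by (rule Bochner_Integration.integrable_bound[of _ "\<lambda>\<omega>. 4 * (\<bar>w (n k) (X k \<omega>)\<bar> ^ 3 + \<bar>\<mu> k\<bar> ^ 3)"])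
         (use w3 cube in auto)
    have "sqrt (V k) ^ 3 = V k powr (3 / 2)"
      using V[of k] by (simp add: powr_half_sqrt[symmetric] powr_powr flip: powr_realpow)
    then have eq: "\<bar>G k \<omega>\<bar> ^ 3 = \<bar>w (n k) (X k \<omega>) - \<mu> k\<bar> ^ 3 / V k powr (3 / 2)" for \<omega>
      using V[of k] by (simp add: G_def g_def abs_divide power_divide)
    show "integrable (M' k) (\<lambda>\<omega>. \<bar>G k \<omega>\<bar> ^ 3)"
      "P.expectation k (\<lambda>\<omega>. \<bar>G k \<omega>\<bar> ^ 3) =
        P.expectation k (\<lambda>\<omega>. \<bar>w (n k) (X k \<omega>) - \<mu> k\<bar> ^ 3) / V k powr (3 / 2)"
      unfolding eq using c3 by auto
  qed
  have G_meas [measurable]: "G k \<in> borel_measurable (M' k)" for k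
    unfolding G_def by measurable
  note G12 = P.integrable_lower_powers[OF G_meas G3]
  have G_mean: "P.expectation k (G k) = 0" for k
    unfolding G_def g_def using w12 by (simp add: \<mu>_def P.prob_space)
  have G_var: "P.expectation k (\<lambda>\<omega>. (G k \<omega>)\<^sup>2) = 1" for k
  proof -
    have "P.expectation k (\<lambda>\<omega>. (G k \<omega>)\<^sup>2) = V k / V k"
      using V[of k] by (simp add: G_def g_def power_divide V_def \<mu>_def)
    then show ?thesis using V[of k] by simp
  qed
  have tendsto_n: "(\<lambda>k. f (n k)) \<longlonglongrightarrow> 0" if "f \<in> o(\<lambda>n. 1)" for f :: "nat \<Rightarrow> real"
    using smalloD_tendsto[OF that] LIMSEQ_Suc[of f 0] by (simp add: n_def)
  have third: "(\<lambda>k. P.expectation k (\<lambda>\<omega>. \<bar>G k \<omega>\<bar> ^ 3) / sqrt (N' k)) \<longlonglongrightarrow> 0"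
    using tendsto_n[OF iii_lyapunov] unfolding G3_eq
    by (simp add: \<mu>_def V_def M'_def N'_def X_def mult.commute)
  \<comment> \<open>Standardising both variables turns their correlation into the expectation of the
    product.\<close>
  have corr: "(\<lambda>k. P.expectation k (\<lambda>\<omega>. G k \<omega> * ((real (X k \<omega>) - r k) / s k))) \<longlonglongrightarrow> 0"
  proof -
    have "P.expectation k (\<lambda>\<omega>. real (X k \<omega>)) = r k" for k
      using mixed_poisson.expectation_X[OF mp] by (simp add: r_def)
    then have "corr (M (n k)) (\<lambda>\<omega>. real (Ot (n k) 1 \<omega>)) (\<lambda>\<omega>. w (n k) (Ot (n k) 1 \<omega>)) =
        P.expectation k (\<lambda>\<omega>. (real (X k \<omega>) - r k) * (w (n k) (X k \<omega>) - \<mu> k)) / (s k * sqrt (V k))" for k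
      by (simp add: corr_def covariance_def s_def V_def \<mu>_def M'_def X_def)
    also have "\<dots> k = P.expectation k (\<lambda>\<omega>. G k \<omega> * ((real (X k \<omega>) - r k) / s k))" for k
      by (simp add: G_def g_def mult.commute flip: integral_divide_zero)
    finally show ?thesis using tendsto_n[OF i] by simp
  qed

  \<comment> \<open>Limit of the inversion integral\<close>
  have n_top: "filterlim n at_top sequentially"
    unfolding n_def by (rule filterlim_Suc)
  have N_top: "filterlim N' at_top sequentially"
    unfolding N'_def by (rule filterlim_compose[OF N_tendsto n_top])
  have rate_top: "filterlim (\<lambda>k. real (N' k) * r k) at_top sequentially"
    unfolding Nr by (rule filterlim_compose[OF filterlim_real_sequentially n_top])
  define I where "I k t = (LINT v|lborel.
      indicator {- (pi * (s k * sqrt (N' k)))..pi * (s k * sqrt (N' k))} v *\<^sub>R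
      P.expectation k (\<lambda>\<omega>. iexp ((t * G k \<omega> + v * ((real (X k \<omega>) - r k) / s k)) / sqrt (N' k))) ^ N' k)" for k t
  have I_lim: "(\<lambda>k. I k t) \<longlonglongrightarrow> complex_of_real (sqrt (2 * pi) * exp (- t\<^sup>2 / 2))" for t
    unfolding I_def r_def s_def
    by (rule tendsto_inversion_integral[OF mp G_meas G3 G_mean G_var N'])
       (use r third N_top rate_top corr in \<open>simp_all add: r_def s_def\<close>)

  \<comment> \<open>Unconditional mean and variance of the statistic\<close>
  define T where "T k = T_stat (N' k) (w (n k)) (Ot (n k))" for k
  define B where "B k = {\<omega> \<in> space (M' k). S_total (N' k) (Ot (n k)) \<omega> = n k}" for k
  have w_meas: "(\<lambda>\<omega>. f (Ot (n k) i \<omega>)) \<in> borel_measurable (M' k)" if "i \<in> {1..N' k}" for f :: "nat \<Rightarrow> real" and i k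
    using Ot_meas[OF that] by measurable
  have T_meas: "T k \<in> borel_measurable (M' k)" for k
    unfolding T_def T_stat_def by (rule borel_measurable_sum) (rule w_meas)
  have B_meas: "B k \<in> sets (M' k)" for k
  proof -
    have "(\<lambda>\<omega>. \<Sum>i=1..N' k. real (Ot (n k) i \<omega>)) \<in> borel_measurable (M' k)"
      by (rule borel_measurable_sum) (rule w_meas)
    then have "{\<omega> \<in> space (M' k). (\<Sum>i=1..N' k. real (Ot (n k) i \<omega>)) = real (n k)} \<in> sets (M' k)"
      by measurable
    then show ?thesis by (simp add: B_def S_total_def flip: of_nat_sum)
  qed
  have indepO: "P.indep_vars k (\<lambda>_. count_space UNIV) (Ot (n k)) {1..N' k}" for k
    using P.indep_vars_compose2[OF indep[OF n1, of k, folded M'_def N'_def], of "\<lambda>_. snd" "\<lambda>_. count_space UNIV"]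
    by simp
  have ident: "integrable (M' k) (\<lambda>\<omega>. f (Ot (n k) i \<omega>)) \<longleftrightarrow> integrable (M' k) (\<lambda>\<omega>. f (X k \<omega>))"
    "P.expectation k (\<lambda>\<omega>. f (Ot (n k) i \<omega>)) = P.expectation k (\<lambda>\<omega>. f (X k \<omega>))"
    if "i \<in> {1..N' k}" for f :: "nat \<Rightarrow> real" and i k
    by (rule P.expectation_comp_nat_eq; use that Ot_meas law in simp)+
  have ET: "P.expectation k (T k) = N' k * \<mu> k" for k
    unfolding T_def T_stat_def
    by (subst Bochner_Integration.integral_sum) (use w12 in \<open>auto simp: ident \<mu>_def\<close>)
  have T_std: "(T k \<omega> - N' k * \<mu> k) = sqrt (V k) * (\<Sum>i=1..N' k. g k (Ot (n k) i \<omega>))" for k \<omega>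
    using V[of k] by (simp add: T_def T_stat_def g_def sum_distrib_left sum_subtractf)
  \<comment> \<open>After standardisation the summands are independent, centred and of second moment
    1, so the squared sum has mean \<open>N' k\<close>.\<close>
  have VT: "P.variance k (T k) = V k * N' k" for k
  proof -
    have "P.expectation k (\<lambda>\<omega>. (\<Sum>i=1..N' k. g k (Ot (n k) i \<omega>))\<^sup>2) =
        (\<Sum>i=1..N' k. P.expectation k (\<lambda>\<omega>. (g k (Ot (n k) i \<omega>))\<^sup>2))"
    proof (rule P.expectation_sum_square_indep[THEN conjunct2])
      show "P.indep_vars k (\<lambda>_. borel) (\<lambda>i \<omega>. g k (Ot (n k) i \<omega>)) {1..N' k}"
        by (rule P.indep_vars_compose2[OF indepO]) simp
      fix i assume i: "i \<in> {1..N' k}"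
      show "integrable (M' k) (\<lambda>\<omega>. (g k (Ot (n k) i \<omega>))\<^sup>2)"
        using G12(2)[of k] ident(1)[OF i, of "\<lambda>j. (g k j)\<^sup>2"] by (simp add: G_def)
      show "P.expectation k (\<lambda>\<omega>. g k (Ot (n k) i \<omega>)) = 0"
        using G_mean[of k] ident(2)[OF i, of "g k"] by (simp add: G_def[abs_def])
    qed simp
    also have "\<dots> = N' k"
      using G_var[of k] ident(2)[of _ k "\<lambda>j. (g k j)\<^sup>2"] by (simp add: G_def)
    finally have *: "P.expectation k (\<lambda>\<omega>. (\<Sum>i=1..N' k. g k (Ot (n k) i \<omega>))\<^sup>2) = N' k" .
    show ?thesis
      unfolding ET T_std power_mult_distrib using * V[of k] by simp
  qed
  define m where "m k = P.expectation k (T k)" for k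
  define d where "d k = sqrt (P.variance k (T k))" for k
  have d_eq: "d k = sqrt (V k) * sqrt (N' k)" for k
    unfolding d_def VT by (simp add: real_sqrt_mult)
  have T_eq: "(T k \<omega> - m k) / d k = (\<Sum>i=1..N' k. g k (Ot (n k) i \<omega>)) / sqrt (N' k)" for k \<omega>
    unfolding m_def d_eq ET T_std using V[of k] by simp
  have U_eq: "distr (L (n k)) borel (U (n k)) = cond_law (M' k) (T k) (B k)" for k
    using U_law[OF n1] by (simp add: M'_def N'_def T_def B_def)

  \<comment> \<open>Characteristic functions and weak convergence of the conditioned laws\<close>
  define \<nu> where "\<nu> k = distr (L (n k)) borel (\<lambda>\<omega>. (U (n k) \<omega> - m k) / d k)" for k
  note U_meas [measurable] = U_rv[OF n1]
  note ccl = char_standardized_cond_law[OF P.prob_space_axioms L_prob[OF n1] T_meas B_meas U_rv[OF n1] U_eq]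
  have char_eq: "char (\<nu> k) t = I k t / I k 0" for k t
  proof -
    define b where "b = 2 * pi * (s k * sqrt (N' k))"
    have b: "b > 0" using s[of k] N'[of k] by (simp add: b_def)
    define c where "c t = P.expectation k (\<lambda>\<omega>. indicator (B k) \<omega> *\<^sub>R iexp (t * ((T k \<omega> - m k) / d k)))" for t
    have I: "I k t = b * c t" for t
      unfolding I_def G_def b_def c_def T_eq B_def S_total_def
      by (rule P.conditioned_sum_inversion[OF indepO _ law N' s Nr]) simp_all
    \<comment> \<open>At t = 0 the integral measures the conditioning event. Dividing by it
      therefore normalises the restricted expectation and cancels the factor
      \<open>b\<close>.\<close>
    have "c 0 = P.prob k (B k)"
      unfolding c_def using B_meas[of k] by (simp add: scaleR_conv_of_real)
    then show ?thesis
      unfolding \<nu>_def ccl I using b by (simp add: c_def)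
  qed
  have \<nu>: "real_distribution (\<nu> k)" for k
    unfolding \<nu>_def by (rule prob_space.real_distribution_distr[OF L_prob[OF n1]]) measurable
  have weak: "weak_conv_m \<nu> std_normal_distribution"
  proof (rule levy_continuity)
    fix t
    \<comment> \<open>The denominator tends to \<open>sqrt (2 * pi)\<close>, which is not 0 and
      cancels the same factor in the numerator.\<close>
    have "(\<lambda>k. I k t / I k 0) \<longlonglongrightarrow>
        complex_of_real (sqrt (2 * pi) * exp (- t\<^sup>2 / 2)) / complex_of_real (sqrt (2 * pi) * exp (- 0\<^sup>2 / 2))"
      by (intro tendsto_divide I_lim) simp
    then show "(\<lambda>k. char (\<nu> k) t) \<longlonglongrightarrow> char std_normal_distribution t"
      by (simp add: char_eq char_std_normal_distribution)
  qed (simp_all add: \<nu> real_dist_normal_dist)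
  have cont: "isCont (cdf std_normal_distribution) x" for x
  proof -
    interpret std: real_distribution std_normal_distribution by (rule real_dist_normal_dist)
    have "emeasure std_normal_distribution {x} = 0"
      by (subst emeasure_density) (auto intro!: nn_integral_null_set simp: null_sets_def)
    then show ?thesis by (simp add: std.isCont_cdf measure_def)
  qed

  \<comment> \<open>From weak convergence to the supremum distance\<close>
  have unif: "uniform_limit UNIV (\<lambda>k. cdf (\<nu> k)) (cdf std_normal_distribution) sequentially"
    by (rule weak_conv_m_imp_uniform_limit_cdf[OF \<nu> real_dist_normal_dist weak cont])
  define F where "F j x = \<bar>\<P>(\<omega> in L j.
      (U j \<omega> - prob_space.expectation (M j) (T_stat (N j) (w j) (Ot j)))
      / sqrt (prob_space.variance (M j) (T_stat (N j) (w j) (Ot j))) \<le> x) - Phi x\<bar>" for j x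
  have F_eq: "F (n k) x = dist (cdf (\<nu> k) x) (cdf std_normal_distribution x)" for k x
  proof -
    have "cdf (\<nu> k) x = measure (L (n k)) {\<omega> \<in> space (L (n k)). (U (n k) \<omega> - m k) / d k \<le> x}"
      unfolding \<nu>_def cdf_def by (subst measure_distr) (auto intro!: arg_cong[of _ _ "measure _"])
    then show ?thesis
      by (simp add: F_def dist_real_def Phi_def m_def d_def T_def M'_def N'_def)
  qed
  have "(\<lambda>k. SUP x. F (n k) x) \<longlonglongrightarrow> 0"
  proof (rule tendstoI)
    fix e :: real assume "e > 0"
    \<comment> \<open>A supremum preserves only the weak inequality, so \<open>e / 2\<close> is used
      to end strictly below \<open>e\<close>. The value at 0 bounds the supremum from below.\<close>
    then have "\<forall>\<^sub>F k in sequentially. \<forall>x\<in>UNIV. dist (cdf (\<nu> k) x) (cdf std_normal_distribution x) < e / 2"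
      using uniform_limitD[OF unif, of "e / 2"] by simp
    then show "\<forall>\<^sub>F k in sequentially. dist (SUP x. F (n k) x) 0 < e"
    proof eventually_elim
      case (elim k)
      then have le: "F (n k) x \<le> e / 2" for x by (simp add: F_eq less_imp_le)
      then have "(SUP x. F (n k) x) \<le> e / 2" by (intro cSUP_least) auto
      moreover have "F (n k) 0 \<le> (SUP x. F (n k) x)"
        by (intro cSUP_upper bdd_aboveI2[where M = "e / 2"] le) simp
      moreover have "0 \<le> F (n k) 0" by (simp add: F_def)
      ultimately show ?case using \<open>e > 0\<close> by (simp add: dist_real_def)
    qed
  qed
  then have "(\<lambda>j. SUP x. F j x) \<longlonglongrightarrow> 0"
    unfolding n_def by (rule LIMSEQ_imp_Suc)
  then show ?thesis unfolding F_def .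
qed

end
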